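(* The measure $\mu=\mu_1*\nu$ on $X$ is of ribbon type.
   Context: $X$ is the set of families $x=(x_{k,l})_{(k,l)\in\mathbb Z^2}$ in $(\mathbb Z/2\mathbb Z)^{\mathbb Z^2}$ such that $x_{k,l}+x_{k+1,l}+x_{k,l+1}=0$ for all $(k,l)\in\mathbb Z^2$. It is a closed subgroup of the compact group $(\mathbb Z/2\mathbb Z)^{\mathbb Z^2}$, and $\mathbb Z^2$ acts on it by group automorphisms through the commuting maps $T:(x_{k,l})\mapsto(x_{k+1,l})$ and $S:(x_{k,l})\mapsto(x_{k,l+1})$. Let $\mu_0$ be the Haar probability measure of $X$. $Y=\{x\in X\mid x_{0,0}=1\}$. If $x\in Y$, exactly one of $Tx$, $Sx$ belongs to $Y$; it is denoted $\sigma(x)$, which defines $\sigma:Y\to Y$. For $x\in Y$, the $\sigma$-component of $x$ is the set of points $y\in Y$ of the $\mathbb Z^2$-orbit of $x$ for which there exist integers $p,q\ge 0$ with $\sigma^p(x)=\sigma^q(y)$. The $\sigma$-components of a $\mathbb Z^2$-orbit are the $\sigma$-components of its points lying in $Y$. The $\sigma$-antecedents of $x\in Y$ are the elements of $\bigcup_{n\ge 1}\sigma^{-n}(x)$. $Z$ is the set of elements of $Y$ that have infinitely many $\sigma$-antecedents. An atomless, $\mathbb Z^2$-invariant and ergodic Borel probability measure $\mu$ on $X$ is said to be of ribbon type if $\mu(Z)>0$ and there exists a $\mathbb Z^2$-invariant Borel set $B\subset X$ with $\mu(B)=1$ such that: (a) for every $x\in Y\cap B$, the $\sigma$-component of $x$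 contains points of $Z$; (b) for every $x\in Z\cap B$, the set $\sigma^{-1}(x)$ contains one and only one point of $Z$; (c) for every $x\in Y\cap B$, the $\mathbb Z^2$-orbit of $x$ contains infinitely many $\sigma$-components; more precisely, for every $\sigma$-component $C$ of the $\mathbb Z^2$-orbit of $x$ there exists a unique $k\in\mathbb Z$ with $T^kS^{-k}x\in Z\cap C$, and the set $\{k\in\mathbb Z\mid T^kS^{-k}x\in Z\}$ is bounded neither above nor below. Construction of $\mu$. Let $X_1=\{x\in X\mid \forall k,l\in\mathbb Z,\ x_{2k,2l}=0\}$. For $x\in X$ and $k,l\in\mathbb Z$ put $\theta_{2k,2l}(x)=0$ and $\theta_{2k+1,2l}(x)=\theta_{2k,2l+1}(x)=\theta_{2k+1,2l+1}(x)=x_{k,l}$; then $\theta:x\mapsto(\theta_{k,l}(x))_{(k,l)\in\mathbb Z^2}$ is an isomorphism of $X$ onto $X_1$. Put $\mu_1=\frac14(\theta_*\mu_0+T_*\theta_*\mu_0+S_*\theta_*\mu_0+(TS)_*\theta_*\mu_0)$. Let $u=(u_{k,l})\in X$ be defined by $u_{k,l}=0$ if $k-l\equiv 0 \pmod 3$ and $u_{k,l}=1$ otherwise; its $\mathbb Z^2$-orbit is $\{u,Tu,Su\}$. Put $\nu=\frac13(\delta_u+\delta_{Tu}+\delta_{Su})$, where $\delta$ denotes a Dirac mass. Finally $\mu=\mu_1*\nu$ is the convolution product on the group $X$, i.e. the image of $\mu_1\otimes\nu$ under the sum map $X\times X\to X$, $(x,y)\mapsto x+y$. *)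

theory Defs
  imports
    "HOL-Probability.Probability"
    "HOL-Library.Function_Algebras"
    "HOL-Library.Z2"
begin

text \<open>
  The field \<open>bit\<close> with two elements plays the role of \<open>\<int>/2\<int>\<close>. It carries the discrete topology,
  so that the type of configurations carries the product topology, and addition of configurations
  is pointwise.
\<close>

instantiation bit :: discrete_topology
begin

definition open_bit :: "bit set \<Rightarrow> bool"
  where "open_bit A \<longleftrightarrow> True"

instance
  by standard (auto simp: open_bit_def)

end

lemma UNIV_bit: "(UNIV :: bit set) = {0, 1}"
  by (auto intro: bit.exhaust)

instance bit :: second_countable_topology
proof
  have "finite (UNIV :: bit set set)"
    by (simp add: UNIV_bit Finite_Set.finite_set)
  then have "countable (UNIV :: bit set set)"
    by (rule countable_finite)
  moreover have "open S = generate_topology UNIV S" for S :: "bit set"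
    by (auto simp: open_bit_def intro: generate_topology.Basis)
  ultimately show "\<exists>B :: bit set set. countable B \<and> open = generate_topology B"
    by blast
qed

type_synonym config = "int \<times> int \<Rightarrow> bit"


section \<open>The system and its action\<close>

definition led_X :: "config set" where
  "led_X = {x. \<forall>k l. x (k, l) + x (k + 1, l) + x (k, l + 1) = 0}"

text \<open>The \<open>\<int>\<^sup>2\<close>-action: \<open>act m n\<close> is \<open>T\<^sup>m S\<^sup>n\<close>, for integers \<open>m\<close>, \<open>n\<close> of any sign.\<close>

definition act :: "int \<Rightarrow> int \<Rightarrow> config \<Rightarrow> config" where
  "act m n x = (\<lambda>(k, l). x (k + m, l + n))"

definition T :: "config \<Rightarrow> config" where
  "T x = (\<lambda>(k, l). x (k + 1, l))"

definition S :: "config \<Rightarrow> config" where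
  "S x = (\<lambda>(k, l). x (k, l + 1))"

lemma T_eq_act: "T = act 1 0" and S_eq_act: "S = act 0 1"
  by (auto simp: T_def S_def act_def fun_eq_iff)

lemma act_0: "act 0 0 x = x"
  by (simp add: act_def)

lemma act_act: "act m n (act m' n' x) = act (m + m') (n + n') x"
  by (simp add: act_def fun_eq_iff ac_simps)

lemma act_in_X:
  assumes "x \<in> led_X"
  shows "act m n x \<in> led_X"
  unfolding led_X_def
proof (intro CollectI allI)
  fix k l
  have "x (k + m, l + n) + x (k + m + 1, l + n) + x (k + m, l + n + 1) = 0"
    using assms unfolding led_X_def by blast
  then show "act m n x (k, l) + act m n x (k + 1, l) + act m n x (k, l + 1) = 0"
    unfolding act_def by (simp only: prod.case ac_simps)
qed

definition orbit :: "config \<Rightarrow> config set" where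
  "orbit x = {act m n x | m n. True}"

definition invariant_set :: "config set \<Rightarrow> bool" where
  "invariant_set A \<longleftrightarrow> (\<forall>m n. act m n ` A = A)"


section \<open>The map \<open>\<sigma>\<close>\<close>

definition led_Y :: "config set" where
  "led_Y = {x \<in> led_X. x (0, 0) = 1}"

text \<open>
  Only the restriction of \<open>led_sigma\<close> to \<open>led_Y\<close> is meaningful; preimages are therefore always
  intersected with \<open>led_Y\<close>.
\<close>

definition led_sigma :: "config \<Rightarrow> config" where
  "led_sigma x = (if T x \<in> led_Y then T x else S x)"

lemma exactly_one_in_Y:
  assumes "x \<in> led_Y"
  shows "T x \<in> led_Y \<longleftrightarrow> S x \<notin> led_Y"
proof -
  have "T x \<in> led_X" "S x \<in> led_X"
    using assms by (auto simp: T_eq_act S_eq_act led_Y_def intro: act_in_X)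
  moreover have "x (0, 0) + x (1, 0) + x (0, 1) = 0"
  proof -
    have "x (0, 0) + x (0 + 1, 0) + x (0, 0 + 1) = 0"
      using assms unfolding led_Y_def led_X_def by blast
    then show ?thesis by simp
  qed
  ultimately show ?thesis
    using assms
    by (cases "x (1, 0)"; cases "x (0, 1)") (auto simp: led_Y_def T_def S_def)
qed

lemma led_sigma_in_Y: "x \<in> led_Y \<Longrightarrow> led_sigma x \<in> led_Y"
  using exactly_one_in_Y[of x] by (auto simp: led_sigma_def)

definition sigma_component :: "config \<Rightarrow> config set" where
  "sigma_component x =
     {y \<in> led_Y \<inter> orbit x. \<exists>p q. (led_sigma ^^ p) x = (led_sigma ^^ q) y}"

definition sigma_components_of_orbit :: "config \<Rightarrow> config set set" where
  "sigma_components_of_orbit x = sigma_component ` (led_Y \<inter> orbit x)"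

definition sigma_antecedents :: "config \<Rightarrow> config set" where
  "sigma_antecedents x = (\<Union>n\<in>{1..}. {y \<in> led_Y. (led_sigma ^^ n) y = x})"

definition led_Z :: "config set" where
  "led_Z = {x \<in> led_Y. infinite (sigma_antecedents x)}"


section \<open>Measures on \<open>led_X\<close>\<close>

abbreviation borel_X :: "config measure" where
  "borel_X \<equiv> restrict_space borel led_X"

definition borel_prob :: "config measure \<Rightarrow> bool" where
  "borel_prob M \<longleftrightarrow> prob_space M \<and> sets M = sets borel_X"

definition haar_prob :: "config measure \<Rightarrow> bool" where
  "haar_prob M \<longleftrightarrow> borel_prob M \<and> (\<forall>a\<in>led_X. distr M borel_X (\<lambda>x. a + x) = M)"

definition atomless :: "'a measure \<Rightarrow> bool" where
  "atomless M \<longleftrightarrow> (\<forall>A\<in>sets M. emeasure M A > 0 \<longrightarrow>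
     (\<exists>B\<in>sets M. B \<subseteq> A \<and> 0 < emeasure M B \<and> emeasure M B < emeasure M A))"

definition invariant_measure :: "config measure \<Rightarrow> bool" where
  "invariant_measure M \<longleftrightarrow> (\<forall>m n. distr M borel_X (act m n) = M)"

definition ergodic :: "config measure \<Rightarrow> bool" where
  "ergodic M \<longleftrightarrow> (\<forall>A\<in>sets M. invariant_set A \<longrightarrow> measure M A = 0 \<or> measure M A = 1)"

definition ribbon_type :: "config measure \<Rightarrow> bool" where
  "ribbon_type M \<longleftrightarrow>
     borel_prob M \<and> atomless M \<and> invariant_measure M \<and> ergodic M \<and>
     measure M led_Z > 0 \<and>
     (\<exists>B\<in>sets borel_X. invariant_set B \<and> measure M B = 1 \<and>
        (\<forall>x\<in>led_Y \<inter> B. sigma_component x \<inter> led_Z \<noteq> {}) \<and>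
        (\<forall>x\<in>led_Z \<inter> B. \<exists>!y. y \<in> led_Y \<and> led_sigma y = x \<and> y \<in> led_Z) \<and>
        (\<forall>x\<in>led_Y \<inter> B.
           infinite (sigma_components_of_orbit x) \<and>
           (\<forall>C\<in>sigma_components_of_orbit x. \<exists>!k. act k (- k) x \<in> led_Z \<inter> C) \<and>
           \<not> bdd_above {k. act k (- k) x \<in> led_Z} \<and>
           \<not> bdd_below {k. act k (- k) x \<in> led_Z}))"

text \<open>The arithmetic mean of a nonempty list of Borel measures on \<open>led_X\<close>.\<close>

definition mean_measure :: "config measure list \<Rightarrow> config measure" where
  "mean_measure Ms =
     measure_of led_X (sets borel_X) (\<lambda>A. (\<Sum>M\<leftarrow>Ms. emeasure M A) / of_nat (length Ms))"

definition convolution_X :: "config measure \<Rightarrow> config measure \<Rightarrow> config measure" where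
  "convolution_X M N = distr (M \<Otimes>\<^sub>M N) borel_X (\<lambda>(x, y). x + y)"

lemma space_borel_X: "space borel_X = led_X"
  by (simp add: space_restrict_space)

lemma measurable_to_borel_X:
  assumes "\<And>x. x \<in> space M \<Longrightarrow> f x \<in> led_X" "\<And>p. (\<lambda>x. f x p) \<in> borel_measurable M"
  shows "f \<in> measurable M borel_X"
  using assms
  by (intro measurable_restrict_space2 measurable_coordinatewise_then_product) auto

lemma measurable_coordinate_X [measurable]: "(\<lambda>x. x p) \<in> borel_measurable borel_X"
  by (intro measurable_restrict_space1 measurable_product_coordinates)

lemma act_measurable: "act m n \<in> measurable borel_X borel_X"
proof (rule measurable_to_borel_X)
  show "(\<lambda>x. act m n x p) \<in> borel_measurable borel_X" for p
    by (cases p) (simp add: act_def)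
qed (simp add: space_borel_X act_in_X)

lemma plus_measurable: "(\<lambda>(x, y). x + y) \<in> measurable (borel_X \<Otimes>\<^sub>M borel_X) borel_X"
proof (rule measurable_to_borel_X)
  fix z assume "z \<in> space (borel_X \<Otimes>\<^sub>M borel_X)"
  then obtain x y where z: "z = (x, y)" "x \<in> led_X" "y \<in> led_X"
    by (auto simp: space_pair_measure space_borel_X)
  have "(x (k, l) + y (k, l)) + (x (k + 1, l) + y (k + 1, l)) + (x (k, l + 1) + y (k, l + 1)) = 0"
    for k l
  proof -
    have "x (k, l) + x (k + 1, l) + x (k, l + 1) = 0" "y (k, l) + y (k + 1, l) + y (k, l + 1) = 0"
      using z unfolding led_X_def by blast+
    then have "(x (k, l) + x (k + 1, l) + x (k, l + 1)) + (y (k, l) + y (k + 1, l) + y (k, l + 1)) = 0"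
      by (simp only: add_0_left)
    then show ?thesis
      by (simp only: ac_simps)
  qed
  then show "(case z of (x, y) \<Rightarrow> x + y) \<in> led_X"
    unfolding z led_X_def by simp
next
  fix p :: "int \<times> int"
  have open_all: "open A" for A :: "(bit \<times> bit) set"
  proof (rule open_prod_intro)
    fix z assume "z \<in> A"
    have "open {fst z}" "open {snd z}"
      unfolding open_bit_def by (rule TrueI)+
    moreover have "z \<in> {fst z} \<times> {snd z}"
      by (simp add: mem_Times_iff)
    moreover have "{fst z} \<times> {snd z} \<subseteq> A"
    proof
      fix w assume "w \<in> {fst z} \<times> {snd z}"
      then have "w = z" by (simp add: mem_Times_iff prod_eq_iff)
      then show "w \<in> A" using \<open>z \<in> A\<close> by (simp only:)
    qed
    ultimately show "\<exists>B C. open B \<and> open C \<and> z \<in> B \<times> C \<and> B \<times> C \<subseteq> A"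
      by (intro exI conjI)
  qed
  have "(\<lambda>(a, b). a + b) \<in> measurable (borel :: (bit \<times> bit) measure) (borel :: bit measure)"
    by (rule borel_measurable_continuous_onI) (simp add: continuous_on_open_vimage open_all)
  moreover have "(\<lambda>z. (fst z p, snd z p)) \<in>
      measurable (borel_X \<Otimes>\<^sub>M borel_X) (borel :: (bit \<times> bit) measure)"
    unfolding borel_prod[symmetric] by measurable
  ultimately have "(\<lambda>z. case (fst z p, snd z p) of (a, b) \<Rightarrow> a + b) \<in> borel_measurable (borel_X \<Otimes>\<^sub>M borel_X)"
    by (rule measurable_compose[rotated])
  then show "(\<lambda>z. (case z of (x, y) \<Rightarrow> x + y) p) \<in> borel_measurable (borel_X \<Otimes>\<^sub>M borel_X)"
    by (simp add: case_prod_beta)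
qed

lemma sets_mean_measure [simp]: "sets (mean_measure Ms) = sets borel_X"
  using sets.sigma_sets_eq[of borel_X] sets.space_closed[of borel_X]
  by (simp add: mean_measure_def space_borel_X)

lemma emeasure_mean_measure:
  assumes Ms: "\<And>M. M \<in> set Ms \<Longrightarrow> sets M = sets borel_X"
    and A: "A \<in> sets borel_X"
  shows "emeasure (mean_measure Ms) A = (\<Sum>M\<leftarrow>Ms. emeasure M A) / of_nat (length Ms)"
proof (rule emeasure_measure_of[OF mean_measure_def])
  show "sets borel_X \<subseteq> Pow led_X"
    using sets.space_closed[of borel_X] by (simp add: space_borel_X)
  show "A \<in> sets (mean_measure Ms)"
    using A by simp
  show "positive (sets (mean_measure Ms)) (\<lambda>A. (\<Sum>M\<leftarrow>Ms. emeasure M A) / of_nat (length Ms))"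
    by (simp add: positive_def)
  show "countably_additive (sets (mean_measure Ms))
     (\<lambda>A. (\<Sum>M\<leftarrow>Ms. emeasure M A) / of_nat (length Ms))"
  proof (rule countably_additiveI)
    fix F :: "nat \<Rightarrow> config set"
    assume F: "range F \<subseteq> sets (mean_measure Ms)" "disjoint_family F"
    have "(\<Sum>i. (\<Sum>M\<leftarrow>Ms. emeasure M (F i))) = (\<Sum>M\<leftarrow>Ms. emeasure M (\<Union>i. F i))"
      using Ms
    proof (induction Ms)
      case (Cons M Ms)
      have "(\<Sum>i. emeasure M (F i)) = emeasure M (\<Union>i. F i)"
        using F Cons.prems[of M] by (intro suminf_emeasure) auto
      then show ?case
        using Cons by (simp add: suminf_add[symmetric])
    qed simp
    then show "(\<Sum>i. (\<Sum>M\<leftarrow>Ms. emeasure M (F i)) / of_nat (length Ms)) =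
        (\<Sum>M\<leftarrow>Ms. emeasure M (\<Union>i. F i)) / of_nat (length Ms)"
      by (simp add: divide_ennreal_def)
  qed
qed


section \<open>The measure \<open>\<mu>\<^sub>1 * \<nu>\<close>\<close>

text \<open>As \<open>div\<close> on integers rounds down, \<open>(2 * k + 1) div 2 = k\<close> also for negative \<open>k\<close>.\<close>

definition theta :: "config \<Rightarrow> config" where
  "theta x = (\<lambda>(k, l). if even k \<and> even l then 0 else x (k div 2, l div 2))"

lemma theta_simps:
  "theta x (2 * k, 2 * l) = 0"
  "theta x (2 * k + 1, 2 * l) = x (k, l)"
  "theta x (2 * k, 2 * l + 1) = x (k, l)"
  "theta x (2 * k + 1, 2 * l + 1) = x (k, l)"
  by (simp_all add: theta_def)

lemma theta_in_X:
  assumes "x \<in> led_X"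
  shows "theta x \<in> led_X"
  unfolding led_X_def
proof (intro CollectI allI)
  fix k l :: int
  have *: "x (i, j) + x (i + 1, j) + x (i, j + 1) = 0" for i j
    using assms unfolding led_X_def by blast
  show "theta x (k, l) + theta x (k + 1, l) + theta x (k, l + 1) = 0"
  proof (cases "even k"; cases "even l")
    assume "even k" "even l"
    then show ?thesis by (auto simp: theta_def)
  next
    assume "even k" "odd l"
    then show ?thesis by (auto simp: theta_def)
  next
    assume "odd k" "even l"
    then show ?thesis by (auto simp: theta_def)
  next
    assume kl: "odd k" "odd l"
    then have "(k + 1) div 2 = k div 2 + 1" "(l + 1) div 2 = l div 2 + 1"
      by presburger+
    then show ?thesis
      using *[of "k div 2" "l div 2"] kl unfolding theta_def by simp
  qed
qed

lemma theta_measurable: "theta \<in> measurable borel_X borel_X"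
proof (rule measurable_to_borel_X)
  show "(\<lambda>x. theta x p) \<in> borel_measurable borel_X" for p
    by (cases p) (simp add: theta_def)
qed (simp add: space_borel_X theta_in_X)

definition mu1 :: "config measure \<Rightarrow> config measure" where
  "mu1 \<mu>0 = (let M = distr \<mu>0 borel_X theta in
     mean_measure [M, distr M borel_X T, distr M borel_X S, distr M borel_X (T \<circ> S)])"

definition u :: config where
  "u = (\<lambda>(k, l). if (k - l) mod 3 = 0 then 0 else 1)"

lemma u_in_X: "u \<in> led_X"
  unfolding led_X_def
proof (intro CollectI allI)
  fix k l :: int
  define d where "d = k - l"
  have e: "k + 1 - l = d + 1" "k - (l + 1) = d - 1"
    by (simp_all add: d_def)
  consider "d mod 3 = 0" | "d mod 3 = 1" | "d mod 3 = 2"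
    by linarith
  then show "u (k, l) + u (k + 1, l) + u (k, l + 1) = 0"
  proof cases
    case 1
    then have "(d + 1) mod 3 = 1" "(d - 1) mod 3 = 2" by presburger+
    with 1 show ?thesis by (simp add: u_def e d_def[symmetric])
  next
    case 2
    then have "(d + 1) mod 3 = 2" "(d - 1) mod 3 = 0" by presburger+
    with 2 show ?thesis by (simp add: u_def e d_def[symmetric])
  next
    case 3
    then have "(d + 1) mod 3 = 0" "(d - 1) mod 3 = 1" by presburger+
    with 3 show ?thesis by (simp add: u_def e d_def[symmetric])
  qed
qed

definition nu :: "config measure" where
  "nu = mean_measure [return borel_X u, return borel_X (T u), return borel_X (S u)]"

end

theory Submission
  imports Defs
begin

text \<open>
  Up to a translation, a typical point for \<open>\<mu>\<close> is \<open>y = u + theta z\<close> with \<open>z\<close> typical for Haar measure. The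
  map \<open>\<sigma>\<close> follows paths through the positions where \<open>y\<close> is \<open>1\<close>, going right or up. As \<open>theta z\<close>
  vanishes at positions with even coordinates, \<open>y\<close> agrees there with \<open>u\<close>, and this rigid skeleton
  confines the paths: none steps on a diagonal where \<open>k - l\<close> is a multiple of \<open>6\<close>
  (\<open>no_step_to_boundary\<close>), so each path remains, after at most one step, in a strip
  \<open>6 * D < k - l < 6 * D + 6\<close>. These strips carry the ribbons.

  Within a strip, an even level \<open>k + l\<close> contains only two positions. If \<open>z (a, b) = 1\<close> with
  \<open>a - b = 3 * D + 2\<close>, one of the two positions of level \<open>2 * a + 2 * b + 2\<close> carries \<open>0\<close>, and all paths of
  the strip pass through the other one, a gate (\<open>gate_at\<close>). For almost every \<open>z\<close> there are such gates
  arbitrarily high and arbitrarily low. High gates make all paths of the strip merge, so that the strip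
  meets only one component. A position has infinitely many antecedents exactly if it lies on the paths
  from all lower gates of its strip; hence these positions form one bi-infinite path, with one position
  on each level (\<open>ribbon_unique_at_level\<close>, \<open>ribbon_exists_at_level\<close>). All conditions on the orbit
  follow, one ribbon for each integer \<open>D\<close> (\<open>tame_ribbons\<close>).

  On the side of measure, Haar measure is unique, hence invariant under the action. Explicit elements
  of \<open>led_X\<close> built from binomial coefficients show that the exceptional \<open>z\<close> lie in countably many
  subgroups of infinite index, which are null (\<open>haar_null_subgroup\<close>). They also show that elements
  vanishing far to the right are dense, from which ergodicity of horizontal translations follows
  (\<open>haar_ergodic_horizontal\<close>). The measure \<open>\<mu>\<close> is the average of twelve images of Haar measure which the
  action permutes, and on invariant sets the twelve terms agree (\<open>mu_of_invariant\<close>). Thus invariance,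
  ergodicity and almost sure properties of \<open>\<mu>\<close> are inherited from Haar measure.
\<close>

section \<open>Orbits as sets of positions\<close>

text \<open>
  A point of the orbit of \<open>y\<close> is named by the position that it moves to the origin. When \<open>y\<close> has no
  period, names are unique, and every notion of the statement becomes a statement about the
  positions where \<open>y\<close> is \<open>1\<close>: \<open>\<sigma>\<close> moves from such a position to its right or its upper neighbour,
  whichever carries a \<open>1\<close>.
\<close>
definition centred :: "config \<Rightarrow> int \<times> int \<Rightarrow> config" where
  "centred y p = act (fst p) (snd p) y"

definition step :: "config \<Rightarrow> int \<times> int \<Rightarrow> int \<times> int" where
  "step y p = (if y (fst p + 1, snd p) = 1 then (fst p + 1, snd p) else (fst p, snd p + 1))"

text \<open>
  The height \<open>k + l\<close> of a position. It grows by one at each application of \<open>\<sigma>\<close>, while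
  \<open>act k (- k)\<close> preserves it.
\<close>
definition level :: "int \<times> int \<Rightarrow> int" where
  "level p = fst p + snd p"

definition aperiodic :: "config \<Rightarrow> bool" where
  "aperiodic y \<longleftrightarrow> (\<forall>m n. act m n y = y \<longrightarrow> m = 0 \<and> n = 0)"

lemma led_X_relation: "y \<in> led_X \<Longrightarrow> y (k, l) + y (k + 1, l) + y (k, l + 1) = 0"
  by (simp add: led_X_def)

lemma act_centred: "act m n (centred y p) = centred y (fst p + m, snd p + n)"
  by (simp add: centred_def act_act ac_simps)

lemma centred_in_Y: "y \<in> led_X \<Longrightarrow> centred y p \<in> led_Y \<longleftrightarrow> y p = 1"
  by (auto simp: led_Y_def centred_def act_in_X) (simp_all add: act_def)

lemma orbit_centred: "orbit (centred y p) = range (centred y)"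
proof -
  have "\<exists>m n. centred y q = act m n (centred y p)" for q
    by (rule exI[of _ "fst q - fst p"], rule exI[of _ "snd q - snd p"]) (simp add: act_centred)
  then show ?thesis
    by (auto simp: orbit_def act_centred)
qed

lemma inj_centred:
  assumes "aperiodic y"
  shows "inj (centred y)"
proof (rule injI)
  fix p q assume eq: "centred y p = centred y q"
  have "act (- fst q) (- snd q) (centred y p) = act (- fst q) (- snd q) (centred y q)"
    by (simp add: eq)
  then have "act (fst p - fst q) (snd p - snd q) y = y"
    by (simp add: act_centred) (simp add: centred_def act_0)
  then have "fst p - fst q = 0 \<and> snd p - snd q = 0"
    using assms unfolding aperiodic_def by blast
  then show "p = q"
    by (simp add: prod_eq_iff)
qed

lemma step_one:
  assumes "y \<in> led_X" "y p = 1"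
  shows "y (step y p) = 1"
  using led_X_relation[OF assms(1), of "fst p" "snd p"] assms(2)
  by (cases p; cases "y (fst p, snd p + 1)") (auto simp: step_def)

lemma funpow_step_one: "y \<in> led_X \<Longrightarrow> y p = 1 \<Longrightarrow> y ((step y ^^ n) p) = 1"
  by (induction n) (auto intro: step_one)

lemma level_step: "level (step y p) = level p + 1"
  by (simp add: level_def step_def)

lemma level_funpow_step: "level ((step y ^^ n) p) = level p + int n"
  by (induction n) (auto simp: level_step)

lemma sigma_centred:
  assumes "y \<in> led_X"
  shows "led_sigma (centred y p) = centred y (step y p)"
proof -
  have "T (centred y p) \<in> led_Y \<longleftrightarrow> y (fst p + 1, snd p) = 1"
    using centred_in_Y[OF assms(1), of "(fst p + 1, snd p)"] by (simp add: T_eq_act act_centred)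
  then show ?thesis
    by (auto simp: led_sigma_def step_def T_eq_act S_eq_act act_centred)
qed

lemma funpow_sigma_centred:
  "y \<in> led_X \<Longrightarrow> (led_sigma ^^ n) (centred y p) = centred y ((step y ^^ n) p)"
  by (induction n) (auto simp: sigma_centred)

text \<open>
  The exponents are controlled, not only the orbit: this makes the antecedents of a point a family
  indexed by pairs of natural numbers, which is what measurability of \<open>led_Z\<close> needs later.
\<close>
lemma funpow_sigma_eq_act:
  "\<exists>a b :: nat. a + b = n \<and> (led_sigma ^^ n) v = act (int a) (int b) v"
proof (induction n)
  case 0
  then show ?case by (simp add: act_0)
next
  case (Suc n)
  then obtain a b where ab: "a + b = n" "(led_sigma ^^ n) v = act (int a) (int b) v" by blast
  define w where "w = act (int a) (int b) v"
  have "led_sigma w = act (int (Suc a)) (int b) v \<or> led_sigma w = act (int a) (int (Suc b)) v"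
    by (simp add: led_sigma_def T_eq_act S_eq_act act_act w_def)
  moreover have "(led_sigma ^^ Suc n) v = led_sigma w"
    using ab(2) by (simp add: w_def)
  ultimately show ?case
    using ab(1) by (metis add_Suc add_Suc_right)
qed

lemma funpow_sigma_in_orbit: "\<exists>m n. v = act m n ((led_sigma ^^ i) v)"
proof -
  obtain a b where "(led_sigma ^^ i) v = act (int a) (int b) v"
    using funpow_sigma_eq_act by blast
  then have "v = act (- int a) (- int b) ((led_sigma ^^ i) v)"
    by (simp add: act_act act_0)
  then show ?thesis by blast
qed

definition antecedent_positions :: "config \<Rightarrow> int \<times> int \<Rightarrow> (int \<times> int) set" where
  "antecedent_positions y p = {q. y q = 1 \<and> (\<exists>n\<ge>1. (step y ^^ n) q = p)}"

lemma sigma_antecedents_centred: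
  assumes "y \<in> led_X" "aperiodic y"
  shows "sigma_antecedents (centred y p) = centred y ` antecedent_positions y p"
proof (intro set_eqI iffI)
  fix v assume "v \<in> sigma_antecedents (centred y p)"
  then obtain n where n: "n \<ge> 1" "v \<in> led_Y" "(led_sigma ^^ n) v = centred y p"
    by (auto simp: sigma_antecedents_def)
  obtain i j where "v = act i j (centred y p)"
    using funpow_sigma_in_orbit[of v n] n by auto
  then obtain q where q: "v = centred y q"
    by (auto simp: act_centred)
  then have "(step y ^^ n) q = p"
    using n inj_centred[OF assms(2)] by (auto simp: funpow_sigma_centred assms inj_eq)
  then show "v \<in> centred y ` antecedent_positions y p"
    using n q by (auto simp: antecedent_positions_def centred_in_Y assms)
next
  fix v assume "v \<in> centred y ` antecedent_positions y p"
  then show "v \<in> sigma_antecedents (centred y p)"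
    by (auto simp: antecedent_positions_def sigma_antecedents_def centred_in_Y assms
      funpow_sigma_centred)
qed

text \<open>
  The names of the points of \<open>led_Z\<close> in an aperiodic orbit.
\<close>
definition ribbon_positions :: "config \<Rightarrow> (int \<times> int) set" where
  "ribbon_positions y = {p. y p = 1 \<and> infinite (antecedent_positions y p)}"

lemma centred_in_Z:
  assumes "y \<in> led_X" "aperiodic y"
  shows "centred y p \<in> led_Z \<longleftrightarrow> p \<in> ribbon_positions y"
  using inj_centred[OF assms(2)]
  by (auto simp: led_Z_def ribbon_positions_def sigma_antecedents_centred assms centred_in_Y
      finite_image_iff inj_on_subset)

lemma in_sigma_component_centred:
  assumes "y \<in> led_X" "aperiodic y"
  shows "centred y q \<in> sigma_component (centred y p) \<longleftrightarrow>
    y q = 1 \<and> (\<exists>i j. (step y ^^ i) p = (step y ^^ j) q)"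
  using inj_centred[OF assms(2)]
  by (simp add: sigma_component_def orbit_centred funpow_sigma_centred assms centred_in_Y inj_eq)

section \<open>Strips and gates\<close>

text \<open>
  The properties of \<open>y = u + theta z\<close>, for generic \<open>z\<close>, from which the ribbons are read off. The last
  clause says that \<open>z\<close> takes the value \<open>1\<close> arbitrarily far in both directions on each of the diagonals
  \<open>a - b = 3 * D + 2\<close>: there \<open>y (2 * a + 1, 2 * b + 1) = 1 + z (a, b)\<close>.
\<close>
definition tame :: "config \<Rightarrow> bool" where
  "tame y \<longleftrightarrow> y \<in> led_X \<and> aperiodic y \<and> (\<forall>k l. y (2 * k, 2 * l) = u (2 * k, 2 * l)) \<and>
     (\<forall>D N. (\<exists>b\<ge>N. y (2 * (b + 3 * D + 2) + 1, 2 * b + 1) = 0) \<and>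
            (\<exists>b\<le>N. y (2 * (b + 3 * D + 2) + 1, 2 * b + 1) = 0))"

text \<open>
  The band that carries one ribbon. It is delimited by two consecutive diagonals on which \<open>k - l\<close> is a
  multiple of \<open>6\<close>, and no path can enter such a diagonal.
\<close>
definition strip :: "int \<Rightarrow> (int \<times> int) set" where
  "strip D = {p. 6 * D < fst p - snd p \<and> fst p - snd p < 6 * D + 6}"

text \<open>
  On the diagonals \<open>k - l \<equiv> 0\<close> modulo \<open>6\<close> the positions with even coordinates carry \<open>0\<close>, like \<open>u\<close>. At
  the others, \<open>(2 * a + 1, 2 * b + 1)\<close>, the local rule together with the known values \<open>0\<close> at
  \<open>(2 * a, 2 * b)\<close> and \<open>1\<close> at \<open>(2 * a + 2, 2 * b)\<close> shows that a \<open>1\<close> forces \<open>0\<close> at the left and at the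
  lower neighbour, which are the only positions from which a path could come.
\<close>
lemma no_step_to_boundary:
  assumes y: "tame y" and p: "y p = 1"
  shows "(fst (step y p) - snd (step y p)) mod 6 \<noteq> 0"
proof
  obtain k l where q: "step y p = (k, l)" by fastforce
  assume "(fst (step y p) - snd (step y p)) mod 6 = 0"
  then have kl: "(k - l) mod 6 = 0" by (simp add: q)
  have X: "y \<in> led_X" and ev: "\<And>k l. y (2 * k, 2 * l) = u (2 * k, 2 * l)"
    using y by (auto simp: tame_def)
  have one: "y (k, l) = 1" using step_one[OF X p] q by simp
  have "odd k"
  proof
    assume "even k"
    moreover from this have "even l" using kl by presburger
    ultimately obtain a b where "k = 2 * a" "l = 2 * b"
      by (elim evenE)
    moreover have "(k - l) mod 3 = 0" using kl by presburger
    ultimately show False using one ev[of a b] by (simp add: u_def)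
  qed
  then obtain a where a: "k = 2 * a + 1" by (rule oddE)
  from kl \<open>odd k\<close> have "odd l" by presburger
  then obtain b where b: "l = 2 * b + 1" by (rule oddE)
  have m: "(2 * a - 2 * b) mod 3 = 0" "(2 * (a + 1) - 2 * b) mod 3 \<noteq> 0"
    using kl unfolding a b by presburger+
  have 00: "y (2 * a, 2 * b) = 0" and 20: "y (2 * a + 2, 2 * b) = 1"
    using ev[of a b] ev[of "a + 1" b] m by (simp_all add: u_def)
  have "y (2 * a + 1, 2 * b) = 0"
    using led_X_relation[OF X, of "2 * a + 1" "2 * b"] one 20 unfolding a b
    by (cases "y (2 * a + 1, 2 * b)") (simp_all add: ac_simps)
  moreover from this have "y (2 * a, 2 * b + 1) = 0"
    using led_X_relation[OF X, of "2 * a" "2 * b"] 00 by simp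
  moreover have "p = (2 * a, 2 * b + 1) \<or> p = (2 * a + 1, 2 * b)"
    using q unfolding a b by (cases p) (auto simp: step_def split: if_splits)
  ultimately show False using p by auto
qed

text \<open>
  A step changes \<open>k - l\<close> by one, so that leaving a strip would mean stepping on its boundary.
\<close>
lemma step_strip:
  assumes "tame y" "y p = 1" "p \<in> strip D"
  shows "step y p \<in> strip D"
proof -
  have "(fst (step y p) - snd (step y p)) mod 6 \<noteq> 0"
    by (rule no_step_to_boundary[OF assms(1,2)])
  then have "fst (step y p) - snd (step y p) \<noteq> 6 * D" "fst (step y p) - snd (step y p) \<noteq> 6 * D + 6"
    by auto
  moreover have "\<bar>(fst (step y p) - snd (step y p)) - (fst p - snd p)\<bar> \<le> 1"
    by (simp add: step_def)
  ultimately show ?thesis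
    using assms(3) by (auto simp: strip_def)
qed

lemma funpow_step_strip:
  assumes "tame y" "y p = 1" "p \<in> strip D"
  shows "(step y ^^ n) p \<in> strip D"
proof (induction n)
  case (Suc n)
  have "y ((step y ^^ n) p) = 1"
    using assms by (auto simp: tame_def intro: funpow_step_one)
  then show ?case using step_strip[OF assms(1)] Suc by simp
qed (use assms in simp)

lemma step_enters_strip:
  assumes "tame y" "y p = 1"
  obtains D where "step y p \<in> strip D"
proof
  define d where "d = fst (step y p) - snd (step y p)"
  have "d mod 6 \<noteq> 0" unfolding d_def by (rule no_step_to_boundary[OF assms])
  then have "6 * (d div 6) < d \<and> d < 6 * (d div 6) + 6" by presburger
  then show "step y p \<in> strip (d div 6)" by (simp add: strip_def d_def)
qed

text \<open>
  A gate is alone on its level within the strip, so it is a bottleneck for all paths of the strip.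
\<close>
definition gate :: "config \<Rightarrow> int \<Rightarrow> int \<times> int \<Rightarrow> bool" where
  "gate y D g \<longleftrightarrow> y g = 1 \<and> g \<in> strip D \<and>
     (\<forall>p\<in>strip D. y p = 1 \<longrightarrow> level p = level g \<longrightarrow> p = g)"

lemma path_meets_gate:
  assumes "tame y" "gate y D g" "y p = 1" "p \<in> strip D" "level p \<le> level g"
  shows "(step y ^^ nat (level g - level p)) p = g"
proof -
  have "level ((step y ^^ nat (level g - level p)) p) = level g"
    using assms by (simp add: level_funpow_step)
  then show ?thesis
    using assms funpow_step_strip[OF assms(1,3,4)] funpow_step_one[of y p]
    by (auto simp: gate_def tame_def)
qed

text \<open>
  On an even level the strip has only two positions, those with \<open>k - l\<close> equal to \<open>6 * D + 2\<close> and
  \<open>6 * D + 4\<close>. On the level considered here, with \<open>a = b + 3 * D + 2\<close>, they are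
  \<open>(2 * a, 2 * b + 2)\<close>, which has even coordinates and carries \<open>1\<close> as \<open>u\<close> does, and
  \<open>(2 * a + 1, 2 * b + 1)\<close>, which carries \<open>0\<close> by hypothesis.
\<close>
lemma gate_at:
  assumes y: "tame y" and z: "y (2 * (b + 3 * D + 2) + 1, 2 * b + 1) = 0"
  shows "gate y D (2 * (b + 3 * D + 2), 2 * b + 2)"
proof -
  define a where "a = b + 3 * D + 2"
  have ev: "\<And>k l. y (2 * k, 2 * l) = u (2 * k, 2 * l)"
    using y by (auto simp: tame_def)
  have "(2 * a - (2 * b + 2)) mod 3 \<noteq> 0" by (simp add: a_def) presburger
  then have 1: "y (2 * a, 2 * b + 2) = 1"
    using ev[of a "b + 1"] by (simp add: u_def)
  have "p = (2 * a, 2 * b + 2)"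
    if p: "p \<in> strip D" "y p = 1" "level p = level (2 * a, 2 * b + 2)" for p
  proof -
    obtain k l where kl: "p = (k, l)" by fastforce
    have "6 * D < k - l" "k - l < 6 * D + 6" "k + l = 2 * a + 2 * b + 2"
      using p by (simp_all add: kl strip_def level_def)
    then have "k = 2 * a \<and> l = 2 * b + 2 \<or> k = 2 * a + 1 \<and> l = 2 * b + 1"
      unfolding a_def by presburger
    then show ?thesis
      using z p(2) by (auto simp: kl a_def)
  qed
  with 1 show ?thesis
    by (auto simp: gate_def a_def strip_def)
qed

lemma gate_above:
  assumes "tame y"
  obtains g where "gate y D g" "level g \<ge> L"
proof -
  obtain b where "b \<ge> \<bar>L\<bar> + \<bar>6 * D\<bar>" "y (2 * (b + 3 * D + 2) + 1, 2 * b + 1) = 0"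
    using assms unfolding tame_def by blast
  then show ?thesis
    using that[OF gate_at[OF assms]] by (auto simp: level_def)
qed

lemma gate_below:
  assumes "tame y"
  obtains g where "gate y D g" "level g \<le> L"
proof -
  obtain b where "b \<le> - \<bar>L\<bar> - \<bar>6 * D\<bar> - 6" "y (2 * (b + 3 * D + 2) + 1, 2 * b + 1) = 0"
    using assms unfolding tame_def by blast
  then show ?thesis
    using that[OF gate_at[OF assms]] by (auto simp: level_def)
qed

lemma step_ribbon:
  assumes "y \<in> led_X" "p \<in> ribbon_positions y"
  shows "step y p \<in> ribbon_positions y"
proof -
  have "antecedent_positions y p \<subseteq> antecedent_positions y (step y p)"
    by (auto simp: antecedent_positions_def intro!: exI[of _ "Suc n" for n])
  then show ?thesis
    using assms by (auto simp: ribbon_positions_def step_one dest: finite_subset)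
qed

lemma funpow_step_ribbon:
  "y \<in> led_X \<Longrightarrow> p \<in> ribbon_positions y \<Longrightarrow> (step y ^^ n) p \<in> ribbon_positions y"
  by (induction n) (auto intro: step_ribbon)

text \<open>
  Every lower gate of the strip is an antecedent, and there are infinitely many of them.
\<close>
lemma gate_in_ribbon:
  assumes y: "tame y" and g: "gate y D g"
  shows "g \<in> ribbon_positions y"
proof -
  have "infinite (level ` antecedent_positions y g)"
  proof
    assume "finite (level ` antecedent_positions y g)"
    then have "bdd_below (level ` antecedent_positions y g)"
      by (rule bdd_below_finite)
    then obtain M where M: "\<And>q. q \<in> antecedent_positions y g \<Longrightarrow> M \<le> level q"
      by (auto simp: bdd_below_def)
    obtain h where h: "gate y D h" "level h \<le> min (M - 1) (level g - 1)"
      using gate_below[OF y] by blast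
    then have "(step y ^^ nat (level g - level h)) h = g"
      using path_meets_gate[OF y g, of h] by (auto simp: gate_def)
    then have "h \<in> antecedent_positions y g"
      using h by (auto simp: antecedent_positions_def gate_def intro!: exI[of _ "nat (level g - level h)"])
    then show False using M[of h] h by simp
  qed
  then show ?thesis
    using g by (auto simp: ribbon_positions_def gate_def)
qed

lemma step_le: "fst p \<le> fst (step y p) \<and> snd p \<le> snd (step y p)"
  by (simp add: step_def)

lemma funpow_step_le: "fst p \<le> fst ((step y ^^ n) p) \<and> snd p \<le> snd ((step y ^^ n) p)"
proof (induction n)
  case (Suc n)
  then show ?case
    using step_le[of "(step y ^^ n) p" y] by simp
qed simp

text \<open>
  Paths only go right and up, so only finitely many antecedents lie above a given level.
\<close>
lemma low_antecedent:
  assumes "p \<in> ribbon_positions y"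
  shows "\<exists>q\<in>antecedent_positions y p. level q \<le> L"
proof (rule ccontr)
  assume "\<not> ?thesis"
  then have L: "level q > L" if "q \<in> antecedent_positions y p" for q
    using that by fastforce
  have "antecedent_positions y p \<subseteq> {L - snd p..fst p} \<times> {L - fst p..snd p}"
  proof
    fix q assume q: "q \<in> antecedent_positions y p"
    then have "fst q \<le> fst p \<and> snd q \<le> snd p"
      using funpow_step_le[of q _ y] by (auto simp: antecedent_positions_def)
    then show "q \<in> {L - snd p..fst p} \<times> {L - fst p..snd p}"
      using L[OF q] by (cases q) (auto simp: level_def)
  qed
  then have "finite (antecedent_positions y p)"
    by (rule finite_subset) simp
  then show False using assms by (simp add: ribbon_positions_def)
qed

lemma ribbon_not_boundary:
  assumes y: "tame y" and p: "p \<in> ribbon_positions y"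
  obtains D where "p \<in> strip D"
proof -
  obtain q where "q \<in> antecedent_positions y p"
    using low_antecedent[OF p] by blast
  then obtain m where m: "y q = 1" "m \<ge> 1" "(step y ^^ m) q = p"
    by (auto simp: antecedent_positions_def)
  then obtain n where n: "(step y ^^ Suc n) q = p"
    by (cases m) auto
  have "y \<in> led_X" using y by (simp add: tame_def)
  then have "y ((step y ^^ n) q) = 1"
    using m(1) by (rule funpow_step_one)
  from step_enters_strip[OF y this] show ?thesis
    using n that by auto
qed

text \<open>
  A ribbon position has antecedents below the gate. The path from one of them passes through the gate
  before it reaches the ribbon position.
\<close>
lemma ribbon_from_gate:
  assumes y: "tame y" and p: "p \<in> ribbon_positions y" "p \<in> strip D"
    and g: "gate y D g" "level g \<le> level p"
  shows "(step y ^^ nat (level p - level g)) g = p"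
proof -
  obtain q where q: "q \<in> antecedent_positions y p" "level q \<le> level g - 1"
    using low_antecedent[OF p(1)] by blast
  then obtain n where n: "n \<ge> 1" "y q = 1" "(step y ^^ n) q = p"
    by (auto simp: antecedent_positions_def)
  obtain D' where D': "step y q \<in> strip D'"
    using step_enters_strip[OF y n(2)] .
  have X: "y \<in> led_X" using y by (simp add: tame_def)
  obtain m where m: "n = Suc m" using n by (cases n) auto
  have one: "y (step y q) = 1" using step_one[OF X n(2)] .
  have p_eq: "(step y ^^ m) (step y q) = p"
    using n(3) by (simp add: m funpow_swap1)
  then have "p \<in> strip D'" using funpow_step_strip[OF y one D'] by blast
  then have "D' = D" using p(2) by (auto simp: strip_def)
  with D' have q_strip: "step y q \<in> strip D" by simp
  define i where "i = nat (level g - level (step y q))"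
  have g_eq: "(step y ^^ i) (step y q) = g"
    unfolding i_def using path_meets_gate[OF y g(1) one q_strip] q by (simp add: level_step)
  have "level p = level (step y q) + int m" "level g = level (step y q) + int i"
    using level_funpow_step[of m y "step y q"] level_funpow_step[of i y "step y q"]
    by (simp_all add: p_eq g_eq)
  then have "nat (level p - level g) + i = m"
    using g(2) by linarith
  then show ?thesis
    using p_eq g_eq by (metis comp_apply funpow_add)
qed

text \<open>
  Two ribbon positions of the strip lie on the path that starts at a common lower gate.
\<close>
lemma ribbon_unique_at_level:
  assumes y: "tame y" and "p \<in> ribbon_positions y" "p \<in> strip D"
    and "q \<in> ribbon_positions y" "q \<in> strip D" and "level p = level q"
  shows "p = q"
proof -
  obtain g where g: "gate y D g" "level g \<le> level p" using gate_below[OF y] .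
  show ?thesis
    using ribbon_from_gate[OF y assms(2,3) g] ribbon_from_gate[OF y assms(4,5) g(1)] g assms(6)
    by metis
qed

lemma ribbon_exists_at_level:
  assumes y: "tame y"
  obtains p where "p \<in> ribbon_positions y" "p \<in> strip D" "level p = L"
proof -
  obtain g where g: "gate y D g" "level g \<le> L" using gate_below[OF y] .
  show ?thesis
  proof
    show "(step y ^^ nat (L - level g)) g \<in> ribbon_positions y"
      using gate_in_ribbon[OF y g(1)] y by (auto simp: tame_def intro: funpow_step_ribbon)
    show "(step y ^^ nat (L - level g)) g \<in> strip D"
      using g y by (auto simp: gate_def intro: funpow_step_strip)
    show "level ((step y ^^ nat (L - level g)) g) = L"
      using g by (simp add: level_funpow_step)
  qed
qed

text \<open>
  Both paths pass through any gate above the two positions: a strip is contained in one component.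
\<close>
lemma merge_in_strip:
  assumes y: "tame y" and p: "y p = 1" "p \<in> strip D" and q: "y q = 1" "q \<in> strip D"
  obtains i j where "(step y ^^ i) p = (step y ^^ j) q"
proof -
  obtain g where g: "gate y D g" "level g \<ge> max (level p) (level q)"
    using gate_above[OF y] .
  show ?thesis
    by (rule that, rule trans[OF path_meets_gate[OF y g(1) p] path_meets_gate[OF y g(1) q, symmetric]])
      (use g(2) in auto)
qed

text \<open>
  The ribbon position one level below, in the same strip, must step to the given one, because the strip
  has a single ribbon position on each level.
\<close>
lemma ribbon_unique_predecessor:
  assumes y: "tame y" and p: "p \<in> ribbon_positions y"
  shows "\<exists>!q. q \<in> ribbon_positions y \<and> step y q = p"
proof -
  obtain D where D: "p \<in> strip D" using ribbon_not_boundary[OF y p] .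
  obtain q where q: "q \<in> ribbon_positions y" "q \<in> strip D" "level q = level p - 1"
    using ribbon_exists_at_level[OF y] .
  have "y q = 1" using q by (simp add: ribbon_positions_def)
  have X: "y \<in> led_X" using y by (simp add: tame_def)
  have sq: "step y q = p"
    by (rule ribbon_unique_at_level[OF y step_ribbon[OF X q(1)] step_strip[OF y _ q(2)] p D])
      (use q \<open>y q = 1\<close> in \<open>simp_all add: level_step\<close>)
  moreover have "r = q" if r: "r \<in> ribbon_positions y" "step y r = p" for r
  proof -
    obtain D' where D': "r \<in> strip D'" using ribbon_not_boundary[OF y r(1)] .
    have "y r = 1" using r by (simp add: ribbon_positions_def)
    then have "p \<in> strip D'" using step_strip[OF y _ D'] r by simp
    then have "D' = D" using D by (auto simp: strip_def)
    moreover have "level r = level q" using q(3) r(2) level_step[of y r] by simp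
    ultimately show ?thesis using ribbon_unique_at_level[OF y r(1) _ q(1,2)] D' by simp
  qed
  ultimately show ?thesis using q(1) by blast
qed

text \<open>
  The component of \<open>q\<close> is that of the strip which \<open>q\<close> enters after at most one step, so it has exactly
  one ribbon position on each level.
\<close>
lemma component_ribbon_point:
  assumes y: "tame y" and q: "y q = 1"
  shows "\<exists>!r. r \<in> ribbon_positions y \<and> level r = L \<and> (\<exists>i j. (step y ^^ i) q = (step y ^^ j) r)"
proof -
  have X: "y \<in> led_X" using y by (simp add: tame_def)
  obtain D where D: "step y q \<in> strip D" using step_enters_strip[OF y q] .
  note one = step_one[OF X q]
  obtain r where r: "r \<in> ribbon_positions y" "r \<in> strip D" "level r = L"
    using ribbon_exists_at_level[OF y] .
  have "y r = 1" using r by (simp add: ribbon_positions_def)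
  then obtain i j where "(step y ^^ i) (step y q) = (step y ^^ j) r"
    using merge_in_strip[OF y one D _ r(2)] by blast
  then have "(step y ^^ Suc i) q = (step y ^^ j) r"
    by (simp add: funpow_swap1)
  moreover have "s = r" if s: "s \<in> ribbon_positions y" "level s = L"
    "(step y ^^ i) q = (step y ^^ j) s" for s i j
  proof -
    obtain D' where D': "s \<in> strip D'" using ribbon_not_boundary[OF y s(1)] .
    have "y s = 1" using s by (simp add: ribbon_positions_def)
    from funpow_step_strip[OF y this D', of "Suc j"] funpow_step_strip[OF y one D, of i]
    have "(step y ^^ Suc j) s \<in> strip D'" "(step y ^^ Suc i) q \<in> strip D"
      by (simp_all add: funpow_swap1)
    then have "D' = D" using s(3) by (auto simp: strip_def)
    then show ?thesis using ribbon_unique_at_level[OF y s(1) _ r(1,2)] D' s r by simp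
  qed
  ultimately show ?thesis using r by blast
qed

text \<open>
  Since strip \<open>D\<close> has a ribbon position on the level of \<open>p\<close> for every integer \<open>D\<close>, these positions are
  unbounded in both directions. Components are infinitely many because distinct ribbon positions on one
  level belong to distinct components.
\<close>
lemma tame_ribbons:
  assumes y: "tame y" and x: "x = centred y p"
  shows "x \<in> led_Y \<Longrightarrow> sigma_component x \<inter> led_Z \<noteq> {}"
    and "x \<in> led_Z \<Longrightarrow> \<exists>!v. v \<in> led_Y \<and> led_sigma v = x \<and> v \<in> led_Z"
    and "C \<in> sigma_components_of_orbit x \<Longrightarrow> \<exists>!k. act k (- k) x \<in> led_Z \<inter> C"
    and "\<not> bdd_above {k. act k (- k) x \<in> led_Z}"
    and "\<not> bdd_below {k. act k (- k) x \<in> led_Z}"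
    and "infinite (sigma_components_of_orbit x)"
proof -
  have X: "y \<in> led_X" and ap: "aperiodic y" using y by (auto simp: tame_def)
  note [simp] = centred_in_Y[OF X] centred_in_Z[OF X ap] in_sigma_component_centred[OF X ap]
    funpow_sigma_centred[OF X] sigma_centred[OF X] inj_eq[OF inj_centred[OF ap]]
  have one: "y r = 1" if "r \<in> ribbon_positions y" for r
    using that by (simp add: ribbon_positions_def)
  have comps: "sigma_components_of_orbit x = (\<lambda>q. sigma_component (centred y q)) ` {q. y q = 1}"
  proof -
    have "led_Y \<inter> range (centred y) = centred y ` {q. y q = 1}" by auto
    then show ?thesis
      unfolding sigma_components_of_orbit_def x orbit_centred by (simp only: image_image)
  qed
  have act_x: "act k (- k) x = centred y (fst p + k, snd p - k)" for k
    by (simp add: x act_centred)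
  show "sigma_component x \<inter> led_Z \<noteq> {}" if "x \<in> led_Y"
  proof -
    have "y p = 1" using that by (simp add: x)
    then obtain r i j where "r \<in> ribbon_positions y" "(step y ^^ i) p = (step y ^^ j) r"
      using component_ribbon_point[OF y] by blast
    then have "centred y r \<in> sigma_component x \<inter> led_Z"
      using one[of r] by (auto simp: x)
    then show ?thesis by blast
  qed
  show "\<exists>!v. v \<in> led_Y \<and> led_sigma v = x \<and> v \<in> led_Z" if "x \<in> led_Z"
  proof -
    have "p \<in> ribbon_positions y" using that by (simp add: x)
    then obtain q where q: "q \<in> ribbon_positions y" "step y q = p"
      and uniq: "\<And>r. r \<in> ribbon_positions y \<Longrightarrow> step y r = p \<Longrightarrow> r = q"
      using ribbon_unique_predecessor[OF y] by blast
    show ?thesis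
    proof (rule ex1I[of _ "centred y q"])
      show "centred y q \<in> led_Y \<and> led_sigma (centred y q) = x \<and> centred y q \<in> led_Z"
        using q one by (simp add: x)
      fix v assume v: "v \<in> led_Y \<and> led_sigma v = x \<and> v \<in> led_Z"
      then obtain m n where "v = act m n x"
        using funpow_sigma_in_orbit[of v 1] by auto
      then obtain r where "v = centred y r" by (auto simp: x act_centred)
      then show "v = centred y q" using v uniq by (simp add: x)
    qed
  qed
  show ex1: "\<exists>!k. act k (- k) x \<in> led_Z \<inter> C" if C: "C \<in> sigma_components_of_orbit x" for C
  proof -
    obtain q where q: "y q = 1" "C = sigma_component (centred y q)"
      using C unfolding comps by blast
    obtain r where r: "r \<in> ribbon_positions y" "level r = level p"
        "\<exists>i j. (step y ^^ i) q = (step y ^^ j) r"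
      and uniq: "\<And>s. s \<in> ribbon_positions y \<Longrightarrow> level s = level p \<Longrightarrow>
        \<exists>i j. (step y ^^ i) q = (step y ^^ j) s \<Longrightarrow> s = r"
      using component_ribbon_point[OF y q(1), of "level p"] by blast
    show ?thesis
    proof (rule ex1I[of _ "fst r - fst p"])
      have "(fst p + (fst r - fst p), snd p - (fst r - fst p)) = r"
        using r(2) by (cases r) (auto simp: level_def)
      then show "act (fst r - fst p) (- (fst r - fst p)) x \<in> led_Z \<inter> C"
        using r one unfolding act_x by (auto simp: q)
    next
      fix k assume "act k (- k) x \<in> led_Z \<inter> C"
      then have "(fst p + k, snd p - k) = r"
        by (intro uniq) (auto simp: act_x q level_def)
      then show "k = fst r - fst p" by auto
    qed
  qed
  have ribbon_k: "\<exists>k. act k (- k) x \<in> led_Z \<and> 6 * D < 2 * k + fst p - snd p \<and>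
      2 * k + fst p - snd p < 6 * D + 6" for D
  proof -
    obtain r where r: "r \<in> ribbon_positions y" "r \<in> strip D" "level r = level p"
      using ribbon_exists_at_level[OF y] .
    have "(fst p + (fst r - fst p), snd p - (fst r - fst p)) = r"
      using r(3) by (cases r) (auto simp: level_def)
    then have "act (fst r - fst p) (- (fst r - fst p)) x \<in> led_Z"
      unfolding act_x using r by simp
    moreover have "2 * (fst r - fst p) + fst p - snd p = fst r - snd r"
      using r(3) by (auto simp: level_def)
    ultimately show ?thesis
      using r(2) by (intro exI[of _ "fst r - fst p"]) (auto simp: strip_def)
  qed
  show above: "\<not> bdd_above {k. act k (- k) x \<in> led_Z}"
  proof
    assume "bdd_above {k. act k (- k) x \<in> led_Z}"
    then obtain M where M: "\<And>k. act k (- k) x \<in> led_Z \<Longrightarrow> k \<le> M"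
      by (auto simp: bdd_above_def)
    obtain k where k: "act k (- k) x \<in> led_Z" "6 * (\<bar>M\<bar> + \<bar>fst p - snd p\<bar>) < 2 * k + fst p - snd p"
      using ribbon_k by blast
    have "6 * (a + b) < 2 * k + m - n \<Longrightarrow> k \<le> M \<Longrightarrow> M \<le> a \<Longrightarrow> 0 \<le> a \<Longrightarrow> m - n \<le> b \<Longrightarrow> 0 \<le> b \<Longrightarrow> False"
      for a b m n :: int by presburger
    from this[OF k(2) M[OF k(1)] abs_ge_self abs_ge_zero abs_ge_self abs_ge_zero] show False .
  qed
  show "\<not> bdd_below {k. act k (- k) x \<in> led_Z}"
  proof
    assume "bdd_below {k. act k (- k) x \<in> led_Z}"
    then obtain M where M: "\<And>k. act k (- k) x \<in> led_Z \<Longrightarrow> M \<le> k"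
      by (auto simp: bdd_below_def)
    obtain k where k: "act k (- k) x \<in> led_Z"
        "2 * k + fst p - snd p < 6 * (- \<bar>M\<bar> - \<bar>fst p - snd p\<bar> - 1) + 6"
      using ribbon_k by blast
    have "2 * k + m - n < 6 * (- a - b - 1) + 6 \<Longrightarrow> M \<le> k \<Longrightarrow> - M \<le> a \<Longrightarrow> 0 \<le> a \<Longrightarrow> - (m - n) \<le> b \<Longrightarrow> 0
        \<le> b \<Longrightarrow> False"
      for a b m n :: int by presburger
    from this[OF k(2) M[OF k(1)] abs_ge_minus_self abs_ge_zero abs_ge_minus_self abs_ge_zero] show False .
  qed
  have "inj_on (\<lambda>k. sigma_component (act k (- k) x)) {k. act k (- k) x \<in> led_Z}"
  proof (rule inj_onI)
    fix k k' assume k: "k \<in> {k. act k (- k) x \<in> led_Z}" "k' \<in> {k. act k (- k) x \<in> led_Z}"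
      and eq: "sigma_component (act k (- k) x) = sigma_component (act k' (- k') x)"
    have self: "act k (- k) x \<in> sigma_component (act k (- k) x)" if "act k (- k) x \<in> led_Z" for k
      using that one[of "(fst p + k, snd p - k)"] by (auto simp: act_x intro!: exI[of _ 0])
    have "sigma_component (act k (- k) x) \<in> sigma_components_of_orbit x"
      using k one by (auto simp: comps act_x)
    note unique = ex1[OF this]
    have "act k (- k) x \<in> led_Z \<inter> sigma_component (act k (- k) x)"
      using k(1) self[of k] by blast
    moreover have "act k' (- k') x \<in> led_Z \<inter> sigma_component (act k (- k) x)"
      unfolding eq using k(2) self[of k'] by blast
    ultimately show "k = k'"
      using unique by blast
  qed
  moreover have "infinite {k. act k (- k) x \<in> led_Z}"
    using above by (auto dest: bdd_above_finite)
  ultimately have "infinite ((\<lambda>k. sigma_component (act k (- k) x)) ` {k. act k (- k) x \<in> led_Z})"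
    by (simp add: finite_image_iff)
  moreover have "(\<lambda>k. sigma_component (act k (- k) x)) ` {k. act k (- k) x \<in> led_Z}
      \<subseteq> sigma_components_of_orbit x"
    using one by (auto simp: comps act_x)
  ultimately show "infinite (sigma_components_of_orbit x)"
    using finite_subset by blast
qed

section \<open>Haar measure and its null sets\<close>

lemma config_add_self [simp]: "(a :: config) + a = 0"
  by (rule ext) simp

lemma config_add_cancel [simp]: "(a :: config) + (a + b) = b"
  by (simp add: add.assoc[symmetric])

lemma led_X_add: "a \<in> led_X \<Longrightarrow> b \<in> led_X \<Longrightarrow> a + b \<in> led_X"
  using measurable_space[OF plus_measurable, of "(a, b)"]
  by (simp add: space_pair_measure space_borel_X)

lemma led_X_0: "0 \<in> led_X"
  by (simp add: led_X_def)

lemma act_add: "act m n (a + b) = act m n a + act m n b"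
  by (auto simp: act_def)

lemma translate_measurable: "a \<in> led_X \<Longrightarrow> (\<lambda>x. a + x) \<in> measurable borel_X borel_X"
  using measurable_compose[OF measurable_Pair1' plus_measurable, of a]
  by (simp add: space_borel_X)

lemma coordinate_pred [measurable]: "Measurable.pred borel_X (\<lambda>x. x p = c)"
proof -
  have "{c} \<in> sets (borel :: bit measure)"
    by (rule borel_open) (simp add: open_bit_def)
  from measurable_sets[OF measurable_coordinate_X this, of p] show ?thesis
    by (auto simp: pred_def vimage_def space_borel_X intro: back_subst[of "\<lambda>A. A \<in> sets borel_X"])
qed

lemma coordinates_eq_pred [measurable]: "Measurable.pred borel_X (\<lambda>x. x p = x q)"
proof -
  have "x p = x q \<longleftrightarrow> x p = 0 \<and> x q = 0 \<or> x p = 1 \<and> x q = 1" for x :: config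
    by (cases "x p"; cases "x q") auto
  then show ?thesis by (simp del: bit_not_zero_iff bit_not_one_iff)
qed

lemma haar_prob_space: "haar_prob M \<Longrightarrow> prob_space M"
  and haar_sets: "haar_prob M \<Longrightarrow> sets M = sets borel_X"
  by (auto simp: haar_prob_def borel_prob_def)

lemma haar_space: "haar_prob M \<Longrightarrow> space M = led_X"
  using sets_eq_imp_space_eq[OF haar_sets] by (simp add: space_borel_X)

lemma haar_translate:
  assumes M: "haar_prob M" and a: "a \<in> led_X" and A: "A \<in> sets borel_X"
  shows "emeasure M {x \<in> led_X. a + x \<in> A} = emeasure M A"
proof -
  have "emeasure M A = emeasure (distr M borel_X (\<lambda>x. a + x)) A"
    using M a by (simp add: haar_prob_def)
  also have "\<dots> = emeasure M ((\<lambda>x. a + x) -` A \<inter> space M)"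
    using translate_measurable[OF a]
        by (intro emeasure_distr A) (simp add: haar_sets[OF M] cong: measurable_cong_sets)
  also have "(\<lambda>x. a + x) -` A \<inter> space M = {x \<in> led_X. a + x \<in> A}"
    by (auto simp: haar_space[OF M])
  finally show ?thesis by simp
qed

text \<open>
  The usual argument: by Fubini and invariance, the measure of \<open>{(x, y). x + y \<in> A}\<close> under the product
  \<open>M \<Otimes>\<^sub>M N\<close> equals both \<open>M A\<close> and \<open>N A\<close>.
\<close>
lemma haar_unique:
  assumes M: "haar_prob M" and N: "haar_prob N"
  shows "M = N"
proof (rule measure_eqI)
  show "sets M = sets N" using haar_sets M N by simp
next
  fix A assume "A \<in> sets M"
  then have A: "A \<in> sets borel_X" using haar_sets[OF M] by simp
  interpret M: prob_space M by (rule haar_prob_space[OF M])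
  interpret N: prob_space N by (rule haar_prob_space[OF N])
  interpret pair_prob_space M N ..
  define Q where "Q = {z \<in> space (M \<Otimes>\<^sub>M N). fst z + snd z \<in> A}"
  have "sets (M \<Otimes>\<^sub>M N) = sets (borel_X \<Otimes>\<^sub>M borel_X)"
    using haar_sets[OF M] haar_sets[OF N] by (rule sets_pair_measure_cong)
  then have "(\<lambda>(x, y). x + y) \<in> measurable (M \<Otimes>\<^sub>M N) borel_X"
    using plus_measurable by (simp cong: measurable_cong_sets)
  from measurable_sets[OF this A] have Q: "Q \<in> sets (M \<Otimes>\<^sub>M N)"
    by (auto simp: Q_def vimage_def case_prod_beta Int_def conj_commute)
  have "emeasure (M \<Otimes>\<^sub>M N) Q = (\<integral>\<^sup>+x. emeasure N (Pair x -` Q) \<partial>M)"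
    by (rule N.emeasure_pair_measure_alt[OF Q])
  also have "\<dots> = (\<integral>\<^sup>+x. emeasure N A \<partial>M)"
  proof (rule nn_integral_cong)
    fix x assume "x \<in> space M"
    then have x: "x \<in> led_X" by (simp add: haar_space[OF M])
    then have "Pair x -` Q = {y \<in> led_X. x + y \<in> A}"
      by (auto simp: Q_def space_pair_measure haar_space[OF M] haar_space[OF N])
    then show "emeasure N (Pair x -` Q) = emeasure N A"
      using haar_translate[OF N x A] by simp
  qed
  also have "\<dots> = emeasure N A"
    by (simp add: M.emeasure_space_1)
  finally have 1: "emeasure (M \<Otimes>\<^sub>M N) Q = emeasure N A" .
  have "emeasure (M \<Otimes>\<^sub>M N) Q = (\<integral>\<^sup>+y. emeasure M ((\<lambda>x. (x, y)) -` Q) \<partial>N)"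
    by (rule emeasure_pair_measure_alt2[OF Q])
  also have "\<dots> = (\<integral>\<^sup>+y. emeasure M A \<partial>N)"
  proof (rule nn_integral_cong)
    fix y assume "y \<in> space N"
    then have y: "y \<in> led_X" by (simp add: haar_space[OF N])
    then have "(\<lambda>x. (x, y)) -` Q = {x \<in> led_X. y + x \<in> A}"
      by (auto simp: Q_def space_pair_measure haar_space[OF M] haar_space[OF N] add.commute)
    then show "emeasure M ((\<lambda>x. (x, y)) -` Q) = emeasure M A"
      using haar_translate[OF M y A] by simp
  qed
  also have "\<dots> = emeasure M A"
    by (simp add: N.emeasure_space_1)
  finally show "emeasure M A = emeasure N A" using 1 by simp
qed

text \<open>
  The image of Haar measure under a group automorphism is again translation invariant.
\<close>
lemma haar_act:
  assumes M: "haar_prob M"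
  shows "distr M borel_X (act m n) = M"
proof (rule haar_unique[OF _ M])
  interpret prob_space M by (rule haar_prob_space[OF M])
  have meas: "act m n \<in> measurable M borel_X"
    using act_measurable haar_sets[OF M] by (simp cong: measurable_cong_sets)
  show "haar_prob (distr M borel_X (act m n))"
    unfolding haar_prob_def borel_prob_def
  proof (intro conjI ballI)
    show "prob_space (distr M borel_X (act m n))" by (rule prob_space_distr[OF meas])
    fix a assume a: "a \<in> led_X"
    define b where "b = act (- m) (- n) a"
    have b: "b \<in> led_X" and ab: "a = act m n b"
      using a by (auto simp: b_def act_in_X act_act act_0)
    have tb: "(\<lambda>x. b + x) \<in> measurable M borel_X"
      using translate_measurable[OF b] haar_sets[OF M] by (simp cong: measurable_cong_sets)
    have "distr (distr M borel_X (act m n)) borel_X (\<lambda>x. a + x) = distr M borel_X ((\<lambda>x. a + x) \<circ>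
        act m n)"
      using translate_measurable[OF a] meas by (intro distr_distr) auto
    also have "(\<lambda>x. a + x) \<circ> act m n = act m n \<circ> (\<lambda>x. b + x)"
      by (simp add: fun_eq_iff[where 'a=config] ab act_add)
    also have "distr M borel_X (act m n \<circ> (\<lambda>x. b + x))
        = distr (distr M borel_X (\<lambda>x. b + x)) borel_X (act m n)"
      using tb act_measurable by (intro distr_distr[symmetric]) auto
    also have "distr M borel_X (\<lambda>x. b + x) = M"
      using M b by (simp add: haar_prob_def)
    finally show "distr (distr M borel_X (act m n)) borel_X (\<lambda>x. a + x)
        = distr M borel_X (act m n)" .
  qed simp
qed

lemma haar_act_measure:
  assumes M: "haar_prob M" and A: "A \<in> sets borel_X"
  shows "measure M {x \<in> led_X. act m n x \<in> A} = measure M A"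
proof -
  have "act m n \<in> measurable M borel_X"
    using act_measurable haar_sets[OF M] by (simp cong: measurable_cong_sets)
  then have "measure (distr M borel_X (act m n)) A = measure M (act m n -` A \<inter> space M)"
    using A by (rule measure_distr)
  moreover have "act m n -` A \<inter> space M = {x \<in> led_X. act m n x \<in> A}"
    by (auto simp: haar_space[OF M])
  ultimately show ?thesis
    by (simp add: haar_act[OF M])
qed

text \<open>
  A subgroup with infinitely many cosets is null, as the cosets are disjoint and have equal measure. In
  this group \<open>x = - x\<close>, so that \<open>g i + g j \<notin> A\<close> says that \<open>g i\<close> and \<open>g j\<close> lie in distinct cosets.
\<close>
lemma haar_null_subgroup:
  assumes M: "haar_prob M" and A: "A \<in> sets borel_X"
    and add: "\<And>x y. x \<in> A \<Longrightarrow> y \<in> A \<Longrightarrow> x + y \<in> A"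
    and g: "\<And>i. g i \<in> led_X" "\<And>i j :: nat. i \<noteq> j \<Longrightarrow> g i + g j \<notin> A"
  shows "AE x in M. x \<notin> A"
proof -
  interpret prob_space M by (rule haar_prob_space[OF M])
  define F where "F i = {x \<in> led_X. g i + x \<in> A}" for i
  have F: "F i \<in> sets M" for i
    using measurable_sets[OF translate_measurable[OF g(1)[of i]] A]
    by (auto simp: F_def vimage_def space_borel_X haar_sets[OF M] Int_def conj_commute)
  have "disjoint_family F"
    unfolding disjoint_family_on_def
  proof (intro ballI impI equals0I)
    fix i j x assume ij: "i \<noteq> j" and "x \<in> F i \<inter> F j"
    then have "g i + x \<in> A" "g j + x \<in> A"
      by (simp_all add: F_def)
    then have "(g i + x) + (g j + x) \<in> A"
      by (rule add)
    also have "(g i + x) + (g j + x) = g i + g j"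
      by (simp add: ac_simps)
    finally show False using g(2)[OF ij] by contradiction
  qed
  then have "(\<lambda>i. measure M (F i)) sums measure M (\<Union>i. F i)"
    using F by (intro finite_measure_UNION) auto
  moreover have "measure M (F i) = measure M A" for i
    using haar_translate[OF M g(1)[of i] A] by (simp add: F_def measure_def)
  ultimately have "summable (\<lambda>i :: nat. measure M A)"
    by (simp add: sums_iff)
  then have "measure M A = 0"
    using summable_const_iff by blast
  then have "A \<in> null_sets M"
    using A haar_sets[OF M] by (auto simp: emeasure_eq_measure)
  then show ?thesis by (rule AE_not_in)
qed

text \<open>
  The element of \<open>led_X\<close> whose row \<open>l\<close> is given by the binomial coefficients \<open>(l gchoose - k)\<close> modulo \<open>2\<close>,
  with \<open>(l gchoose j)\<close> for negative \<open>l\<close> written, up to sign, as \<open>((- l + j - 1) choose j)\<close>. It is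
  supported in \<open>k \<le> 0\<close>, is constantly \<open>1\<close> on the column \<open>k = 0\<close>, and has a single \<open>1\<close> in row \<open>0\<close>: it
  serves as a source of independence.
\<close>
definition comb :: config where
  "comb = (\<lambda>(k, l). if k > 0 then 0
     else if l \<ge> 0 then of_nat (nat l choose nat (- k))
     else of_nat ((nat (- l) + nat (- k) - 1) choose nat (- k)))"

text \<open>
  This is Pascal's rule, with a separate check at \<open>k = 0\<close> and at the transition from row \<open>-1\<close> to row \<open>0\<close>.
\<close>
lemma comb_in_X: "comb \<in> led_X"
  unfolding led_X_def
proof (intro CollectI allI)
  fix k l :: int
  consider "k > 0" | "k = 0" | j where "k = - int (Suc j)"
  proof -
    have "k > 0 \<or> k = 0 \<or> k = - int (Suc (nat (- k - 1)))" by linarith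
    then show ?thesis using that by blast
  qed
  then show "comb (k, l) + comb (k + 1, l) + comb (k, l + 1) = 0"
  proof cases
    case 1
    then show ?thesis by (simp add: comb_def)
  next
    case 2
    then show ?thesis by (simp add: comb_def)
  next
    case (3 j)
    have nk: "nat (- k) = Suc j" "nat (- (k + 1)) = j" "\<not> k > 0" "\<not> k + 1 > 0"
      using 3 by simp_all
    consider n where "l = int n" | "l = - 1" | n where "l = - int (Suc (Suc n))"
    proof -
      have "l = int (nat l) \<or> l = - 1 \<or> l = - int (Suc (Suc (nat (- l - 2))))" by linarith
      then show ?thesis using that by blast
    qed
    then show ?thesis
    proof cases
      case (1 n)
      have "nat l = n" "nat (l + 1) = Suc n" "l \<ge> 0" "l + 1 \<ge> 0" using 1 by simp_all
      then show ?thesis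
        using nk by (cases "of_nat (n choose j) :: bit"; cases "of_nat (n choose Suc j) :: bit")
          (simp_all add: comb_def)
    next
      case 2
      then show ?thesis using nk by (simp add: comb_def)
    next
      case (3 n)
      have "nat (- l) = Suc (Suc n)" "nat (- (l + 1)) = Suc n" "\<not> l \<ge> 0" "\<not> l + 1 \<ge> 0"
        using 3 by simp_all
      then have "comb (k, l) = of_nat (Suc (Suc (n + j)) choose Suc j)"
          "comb (k + 1, l) = of_nat (Suc (n + j) choose j)"
          "comb (k, l + 1) = of_nat (Suc (n + j) choose Suc j)"
        using nk by (simp_all add: comb_def del: binomial_Suc_Suc)
      then show ?thesis
        by (cases "of_nat (Suc (n + j) choose j) :: bit";
            cases "of_nat (Suc (n + j) choose Suc j) :: bit")
          (simp_all only: binomial_Suc_Suc[of "Suc (n + j)"] of_nat_add, simp_all)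
    qed
  qed
qed

lemma comb_pos: "k > 0 \<Longrightarrow> comb (k, l) = 0"
  by (simp add: comb_def)

lemma comb_column_0: "comb (0, l) = 1"
  by (simp add: comb_def)

lemma comb_row_0: "comb (k, 0) = (if k = 0 then 1 else 0)"
  by (auto simp: comb_def binomial_eq_0)

lemma comb_above: "l \<ge> 0 \<Longrightarrow> k < - l \<Longrightarrow> comb (k, l) = 0"
  by (simp add: comb_def binomial_eq_0)

lemma comb_antidiagonal: "l \<ge> 0 \<Longrightarrow> comb (- l, l) = 1"
  by (simp add: comb_def)

text \<open>
  The configurations that vanish at the prescribed position of each column in \<open>K\<close> form a subgroup.
  Horizontal translates of \<open>comb\<close> with their last nonzero columns in \<open>K\<close> are pairwise incongruent
  modulo it, since the sum of two of them is \<open>1\<close> throughout the larger of these columns.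
\<close>
lemma haar_AE_one_on_columns:
  assumes M: "haar_prob M" and K: "infinite K"
  shows "AE x in M. \<exists>k\<in>K. x (k, r k) = 1"
proof -
  obtain c :: "nat \<Rightarrow> int" where c: "inj c" "range c \<subseteq> K"
    using infinite_countable_subset[OF K] by blast
  define A where "A = {x \<in> space borel_X. \<forall>k\<in>K. x (k, r k) = 0}"
  have "AE x in M. x \<notin> A"
  proof (rule haar_null_subgroup[OF M, where g = "\<lambda>i. act (- c i) 0 comb"])
    show "A \<in> sets borel_X" unfolding A_def by measurable
    show "x + y \<in> A" if "x \<in> A" "y \<in> A" for x y
      using that by (auto simp: A_def space_borel_X led_X_add)
    show "act (- c i) 0 comb \<in> led_X" for i
      by (intro act_in_X comb_in_X)
    fix i j :: nat assume "i \<noteq> j"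
    then have "c i \<noteq> c j" using c(1) by (auto simp: inj_def)
    define k where "k = max (c i) (c j)"
    have "(act (- c i) 0 comb + act (- c j) 0 comb) (k, r k) = 1"
      using \<open>c i \<noteq> c j\<close> by (auto simp: k_def max_def act_def comb_pos comb_column_0)
    moreover have "k \<in> K" using c(2) by (auto simp: k_def max_def)
    ultimately show "act (- c i) 0 comb + act (- c j) 0 comb \<notin> A"
      by (auto simp: A_def simp del: plus_fun_apply)
  qed
  then show ?thesis
    using AE_space
  proof eventually_elim
    case (elim x)
    then show ?case
      by (auto simp: A_def space_borel_X haar_space[OF M])
  qed
qed

text \<open>
  The configurations of a given period form a subgroup. The sum \<open>w\<close> of two horizontal translates of
  \<open>comb\<close> has a last nonzero column, constantly \<open>1\<close>, so that a period of \<open>w\<close> must be vertical.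
  Moreover row \<open>\<bar>n\<bar>\<close> of \<open>w\<close> extends further to the left than row \<open>0\<close>, which excludes vertical periods.
\<close>
lemma haar_AE_not_periodic:
  assumes M: "haar_prob M" and mn: "(m, n) \<noteq> (0, 0)"
  shows "AE x in M. act m n x \<noteq> x"
proof -
  define A where "A = {x \<in> space borel_X. \<forall>p. x (fst p + m, snd p + n) = x p}"
  have A_iff: "x \<in> A \<longleftrightarrow> x \<in> led_X \<and> act m n x = x" for x
    by (auto simp: A_def space_borel_X act_def fun_eq_iff)
  have "AE x in M. x \<notin> A"
  proof (rule haar_null_subgroup[OF M, where g = "\<lambda>i. act (int i) 0 comb"])
    show "A \<in> sets borel_X" unfolding A_def by measurable
    show "x + y \<in> A" if "x \<in> A" "y \<in> A" for x y
      using that by (auto simp: A_iff led_X_add act_add)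
    show "act (int i) 0 comb \<in> led_X" for i
      by (intro act_in_X comb_in_X)
    have main: "False" if ij: "i < j" and per: "act m n w = w"
      and w: "w = act (int i) 0 comb + act (int j) 0 comb" for i j w
    proof -
      have w_eq: "w (k, l) = comb (k + int i, l) + comb (k + int j, l)" for k l
        by (simp add: w act_def)
      have per1: "w (k + m, l + n) = w (k, l)" for k l
        using fun_cong[OF per, of "(k, l)"] by (simp add: act_def)
      have per2: "w (k - m, l - n) = w (k, l)" for k l
        using per1[of "k - m" "l - n"] by simp
      have top: "w (- int i, l) = 1" and beyond: "k > - int i \<Longrightarrow> w (k, l) = 0" for k l
        using ij by (simp_all add: w_eq comb_pos comb_column_0)
      have "m \<le> 0"
        using per1[of "- int i" 0] top[of 0] beyond[of "- int i + m" "0 + n"] by force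
      moreover have "m \<ge> 0"
        using per2[of "- int i" 0] top[of 0] beyond[of "- int i - m" "0 - n"] by force
      ultimately have [simp]: "m = 0" by simp
      then have "n \<noteq> 0" using mn by simp
      \<comment> \<open>one of the two summands has a \<open>1\<close> at the end of its row \<open>\<bar>n\<bar>\<close>, beyond the other one\<close>
      have "w (k, \<bar>n\<bar>) = w (k, 0)" for k
        using per1[of k 0] per2[of k 0] by (cases "n \<ge> 0") auto
      from this[of "- int j - \<bar>n\<bar>"] show False
        using ij \<open>n \<noteq> 0\<close> by
            (auto simp: w_eq comb_row_0 comb_above comb_antidiagonal split: if_splits)
    qed
    fix i j :: nat assume "i \<noteq> j"
    show "act (int i) 0 comb + act (int j) 0 comb \<notin> A"
    proof
      assume "act (int i) 0 comb + act (int j) 0 comb \<in> A"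
      then have per: "act m n (act (int i) 0 comb + act (int j) 0 comb) =
          act (int i) 0 comb + act (int j) 0 comb"
        unfolding A_iff by blast
      consider "i < j" | "j < i" using \<open>i \<noteq> j\<close> by linarith
      then show False
        using main[OF _ per refl] main[OF _ per add.commute] by cases
    qed
  qed
  then show ?thesis
    using AE_space
  proof eventually_elim
    case (elim x)
    then show ?case
      by (auto simp: A_iff haar_space[OF M])
  qed
qed

section \<open>Ergodicity of horizontal translations\<close>

lemma translate_set: "a \<in> led_X \<Longrightarrow> A \<in> sets borel_X \<Longrightarrow> {x \<in> led_X. a + x \<in> A} \<in> sets borel_X"
  using measurable_sets[OF translate_measurable[of a], of A]
  by (simp add: vimage_def space_borel_X Int_def conj_commute)

lemma act_set: "A \<in> sets borel_X \<Longrightarrow> {x \<in> led_X. act m n x \<in> A} \<in> sets borel_X"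
  using measurable_sets[OF act_measurable[of m n], of A]
  by (simp add: vimage_def space_borel_X Int_def conj_commute)

lemma haar_translate_measure:
  "haar_prob M \<Longrightarrow> a \<in> led_X \<Longrightarrow> A \<in> sets borel_X \<Longrightarrow> measure M {x \<in> led_X. a + x \<in> A} = measure M A"
  by (simp add: measure_def haar_translate)

text \<open>
  The set where translation by \<open>g\<close> changes membership in \<open>E\<close>. Its measure is a seminorm of \<open>g\<close>, invariant
  under the maps that preserve \<open>E\<close>. Ergodicity follows once it is shown to vanish, for then the
  normalised restriction of Haar measure to \<open>E\<close> is translation invariant.
\<close>
definition osc :: "config set \<Rightarrow> config \<Rightarrow> config set" where
  "osc E g = {x \<in> led_X. (x \<in> E) \<noteq> (g + x \<in> E)}"

definition vanishes_near :: "int \<Rightarrow> config \<Rightarrow> bool" where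
  "vanishes_near N g \<longleftrightarrow> (\<forall>k l. \<bar>k\<bar> \<le> N \<longrightarrow> \<bar>l\<bar> \<le> N \<longrightarrow> g (k, l) = 0)"

lemma osc_Int_X: "g \<in> led_X \<Longrightarrow> osc (E \<inter> led_X) g = osc E g"
  by (auto simp: osc_def led_X_add)

lemma osc_sets:
  assumes "E \<in> sets borel_X" "g \<in> led_X"
  shows "osc E g \<in> sets borel_X"
proof -
  have "E \<subseteq> led_X" using sets.sets_into_space[OF assms(1)] by (simp add: space_borel_X)
  then have "osc E g = (E - {x \<in> led_X. g + x \<in> E}) \<union> ({x \<in> led_X. g + x \<in> E} - E)"
    by (auto simp: osc_def)
  then show ?thesis using translate_set[OF assms(2,1)] assms(1) by simp
qed

text \<open>
  Continuity of translation in measure: an event is determined, up to a small error, by finitely many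
  coordinates, hence hardly affected by translation by an element that vanishes at these. The
  proof runs by induction: the events for which the conclusion holds form a sigma-algebra that contains
  the coordinate events.
\<close>
lemma osc_small:
  assumes M: "haar_prob M" and E: "E \<in> sets (borel :: config measure)" and "e > 0"
  shows "\<exists>N. \<forall>g\<in>led_X. vanishes_near N g \<longrightarrow> measure M (osc E g) < e"
proof -
  interpret prob_space M by (rule haar_prob_space[OF M])
  have "sets (borel :: config measure)
      = sigma_sets UNIV {{f. f i \<in> A} | i A. A \<in> sets (borel :: bit measure)}"
    unfolding sets_PiM_equal_borel[symmetric] sets_PiM_single by (simp add: PiE_UNIV_domain)
  with E have "E \<in> sigma_sets UNIV {{f. f i \<in> A} | i A. A \<in> sets (borel :: bit measure)}" by simp
  then show ?thesis using \<open>e > 0\<close>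
  proof (induction arbitrary: e rule: sigma_sets.induct)
    case (Basic F)
    then obtain p A where F: "F = {f. f p \<in> A}" by blast
    have "osc F g = {}" if "vanishes_near (max \<bar>fst p\<bar> \<bar>snd p\<bar>) g" for g
    proof -
      have "g p = 0" using that by (cases p) (auto simp: vanishes_near_def)
      then show ?thesis by (simp add: osc_def F)
    qed
    then show ?case using Basic by (metis measure_empty)
  next
    case Empty
    then show ?case by (simp add: osc_def)
  next
    case (Compl F)
    have "osc (UNIV - F) g = osc F g" for g by (auto simp: osc_def)
    then show ?case using Compl by simp
  next
    case (Union F)
    have sets: "F i \<inter> led_X \<in> sets M" for i
    proof -
      have "F i \<in> sets borel"
        using Union.hyps(1)[of i] unfolding sets_PiM_equal_borel[symmetric] sets_PiM_single
        by (simp add: PiE_UNIV_domain)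
      then show ?thesis by (auto simp: haar_sets[OF M] sets_restrict_space)
    qed
    define U where "U = (\<Union>i. F i \<inter> led_X)"
    define V where "V n = (\<Union>i<n. F i \<inter> led_X)" for n
    have U: "U \<in> sets M" and V: "V n \<in> sets M" for n
      unfolding U_def V_def
      by (rule sets.countable_UN, use sets in blast, rule sets.finite_UN, use sets in simp_all)
    have "(\<lambda>n. measure M (V n)) \<longlonglongrightarrow> measure M (\<Union>n. V n)"
      using V by (intro finite_Lim_measure_incseq)
          (auto simp: incseq_def V_def intro: less_le_trans)
    moreover have "(\<Union>n. V n) = U" by (auto simp: U_def V_def)
    ultimately have "\<forall>\<^sub>F n in sequentially. measure M U - e / 3 < measure M (V n)"
      using Union.prems by (intro order_tendstoD) auto
    then obtain n where n: "measure M U - e / 3 < measure M (V n)"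
      by (auto simp: eventually_sequentially)
    \<comment> \<open>the part of the union that the first \<open>n\<close> events miss\<close>
    define R where "R = U - V n"
    have R: "R \<in> sets M" using U V by (simp add: R_def)
    have "V n \<subseteq> U" by (auto simp: U_def V_def)
    then have mR: "measure M R < e / 3"
      using n finite_measure_Diff[OF U V] by (simp add: R_def)
    have "\<exists>N. \<forall>g\<in>led_X. vanishes_near N g \<longrightarrow> measure M (osc (F i) g) < e / (3 * real (Suc n))" for i
      using Union.IH[of "e / (3 * real (Suc n))" i] Union.prems by simp
    then obtain N where N: "\<And>i g. g \<in> led_X \<Longrightarrow> vanishes_near (N i) g \<Longrightarrow>
        measure M (osc (F i) g) < e / (3 * real (Suc n))"
      by metis
    show ?case
    proof (intro exI ballI impI)
      fix g assume g: "g \<in> led_X" and small: "vanishes_near (Max (insert 0 (N ` {..<n}))) g"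
      have small_i: "vanishes_near (N i) g" if "i < n" for i
      proof -
        have "N i \<le> Max (insert 0 (N ` {..<n}))" using that by (intro Max_ge) auto
        then show ?thesis using small by (force simp: vanishes_near_def)
      qed
      define R' where "R' = {x \<in> led_X. g + x \<in> R}"
      have R': "R' \<in> sets M" "measure M R' = measure M R"
        using R translate_set[OF g] haar_translate_measure[OF M g]
        by (simp_all add: R'_def haar_sets[OF M])
      have osc_i: "osc (F i) g \<in> sets M" for i
        using osc_sets[OF _ g, of "F i \<inter> led_X"] sets[of i]
            by (simp add: osc_Int_X[OF g] haar_sets[OF M])
      have sub: "osc (\<Union>(range F)) g \<subseteq> (\<Union>i<n. osc (F i) g) \<union> (R \<union> R')"
      proof
        fix x assume "x \<in> osc (\<Union>(range F)) g"
        then have x: "x \<in> led_X" "g + x \<in> led_X" "(x \<in> U) \<noteq> (g + x \<in> U)"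
          by (auto simp: osc_def U_def led_X_add g)
        show "x \<in> (\<Union>i<n. osc (F i) g) \<union> (R \<union> R')"
        proof (cases "x \<in> R \<union> R'")
          case False
          then have "(x \<in> V n) \<noteq> (g + x \<in> V n)"
            using x \<open>V n \<subseteq> U\<close> by (auto simp: R'_def R_def)
          then show ?thesis using x by (auto simp: V_def osc_def)
        qed simp
      qed
      have "measure M (osc (\<Union>(range F)) g) \<le> measure M ((\<Union>i<n. osc (F i) g) \<union> (R \<union> R'))"
        using osc_i R R' by (intro finite_measure_mono sub) auto
      also have "\<dots> \<le> measure M (\<Union>i<n. osc (F i) g) + measure M (R \<union> R')"
        using osc_i R R' by (intro measure_Un_le) auto
      also have "measure M (R \<union> R') \<le> measure M R + measure M R'"
        using R R' by (intro measure_Un_le) auto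
      also have "measure M (\<Union>i<n. osc (F i) g) \<le> (\<Sum>i<n. measure M (osc (F i) g))"
        using osc_i by (intro finite_measure_subadditive_finite) auto
      also have "\<dots> \<le> (\<Sum>i<n. e / (3 * real (Suc n)))"
        using N[OF g small_i] by (intro sum_mono) (auto intro: less_imp_le)
      also have "\<dots> \<le> e / 3"
        using Union.prems by (simp add: field_simps)
      finally show "measure M (osc (\<Union>(range F)) g) < e"
        using mR R' by simp
    qed
  qed
qed

lemma osc_add_le:
  assumes M: "haar_prob M" and E: "E \<in> sets borel_X" and g: "g \<in> led_X" "h \<in> led_X"
  shows "measure M (osc E (g + h)) \<le> measure M (osc E g) + measure M (osc E h)"
proof -
  interpret prob_space M by (rule haar_prob_space[OF M])
  define W where "W = {x \<in> led_X. h + x \<in> osc E g}"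
  have W: "W \<in> sets M" and mW: "measure M W = measure M (osc E g)"
    using translate_set[OF g(2) osc_sets[OF E g(1)]] haar_translate_measure[OF M g(2) osc_sets[OF E g(1)]]
    by (simp_all add: W_def haar_sets[OF M])
  have h: "osc E h \<in> sets M" using osc_sets[OF E g(2)] by (simp add: haar_sets[OF M])
  have "osc E (g + h) \<subseteq> W \<union> osc E h"
    using led_X_add[OF g(2)] by (auto simp: osc_def W_def add.assoc)
  then have "measure M (osc E (g + h)) \<le> measure M (W \<union> osc E h)"
    using W h by (intro finite_measure_mono) auto
  also have "\<dots> \<le> measure M W + measure M (osc E h)"
    using W h by (intro measure_Un_le) auto
  finally show ?thesis by (simp add: mW)
qed

lemma osc_act:
  assumes M: "haar_prob M" and E: "E \<in> sets borel_X" and g: "g \<in> led_X"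
    and inv: "\<And>x. x \<in> led_X \<Longrightarrow> act m n x \<in> E \<longleftrightarrow> x \<in> E"
  shows "measure M (osc E (act m n g)) = measure M (osc E g)"
proof -
  have "{x \<in> led_X. act m n x \<in> osc E (act m n g)} = osc E g"
    using inv led_X_add[OF g] by (auto simp: osc_def act_in_X act_add[symmetric])
  then show ?thesis
    using haar_act_measure[OF M osc_sets[OF E act_in_X[OF g, of m n]], of m n] by simp
qed

text \<open>
  Sums of translates of \<open>comb\<close> realise every finite pattern on a row.
\<close>
lemma row_pattern:
  assumes "finite F"
  shows "\<exists>h\<in>led_X. (\<exists>K. \<forall>k l. k > K \<longrightarrow> h (k, l) = 0) \<and> (\<forall>k. h (k, r) = (if k \<in> F then 1 else 0))"
  using assms
proof induction
  case empty
  show ?case by (rule bexI[of _ 0]) (auto simp: led_X_0)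
next
  case (insert a F)
  then obtain h K where h: "h \<in> led_X" "\<And>k l. k > K \<Longrightarrow> h (k, l) = 0"
    "\<And>k. h (k, r) = (if k \<in> F then 1 else 0)" by blast
  define h' where "h' = h + act (- a) (- r) comb"
  have "h' \<in> led_X" using h by (auto simp: h'_def intro: led_X_add act_in_X comb_in_X)
  moreover have "h' (k, l) = 0" if "k > max K a" for k l
    using that h(2)[of k l] comb_pos[of "k - a"] by (simp add: h'_def act_def)
  moreover have "h' (k, r) = (if k \<in> insert a F then 1 else 0)" for k
    using insert.hyps by (auto simp: h'_def act_def h(3) comb_row_0)
  ultimately show ?case by blast
qed

text \<open>
  The local rule determines a row from the one below it, losing one column at each step.
\<close>
lemma vanishes_from_row:
  assumes w: "w \<in> led_X" and row: "\<And>k. a \<le> k \<Longrightarrow> k \<le> b \<Longrightarrow> w (k, r) = 0"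
  shows "a \<le> k \<Longrightarrow> k + int j \<le> b \<Longrightarrow> w (k, r + int j) = 0"
proof (induction j arbitrary: k)
  case (Suc j)
  have "w (k, r + int j) = 0" "w (k + 1, r + int j) = 0"
    using Suc by auto
  then show ?case
    using led_X_relation[OF w, of k "r + int j"] by (simp add: ac_simps)
qed (use row in simp)

text \<open>
  The elements that vanish far to the right are dense: a finite piece of row \<open>- N\<close>, long enough to
  determine the whole window, can be copied by such an element.
\<close>
lemma half_supported_dense:
  assumes g: "g \<in> led_X"
  obtains h K where "h \<in> led_X" "\<And>k l. k > K \<Longrightarrow> h (k, l) = 0" "vanishes_near N (g + h)"
proof -
  define F where "F = {k. - N \<le> k \<and> k \<le> 3 * N \<and> g (k, - N) = 1}"
  have "finite F" by (rule finite_subset[of _ "{- N..3 * N}"]) (auto simp: F_def)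
  from row_pattern[OF this, of "- N"] obtain h K where h: "h \<in> led_X"
    "\<And>k l. k > K \<Longrightarrow> h (k, l) = 0" "\<And>k. h (k, - N) = (if k \<in> F then 1 else 0)" by blast
  have row: "(g + h) (k, - N) = 0" if "- N \<le> k" "k \<le> 3 * N" for k
    using that by (cases "g (k, - N)") (auto simp: h(3) F_def)
  have "vanishes_near N (g + h)"
    unfolding vanishes_near_def
  proof (intro allI impI)
    fix k l :: int assume "\<bar>k\<bar> \<le> N" "\<bar>l\<bar> \<le> N"
    then have "(g + h) (k, - N + int (nat (l + N))) = 0"
      by (intro vanishes_from_row[OF led_X_add[OF g h(1)] row]) auto
    moreover have "- N + int (nat (l + N)) = l" using \<open>\<bar>l\<bar> \<le> N\<close> by simp
    ultimately show "(g + h) (k, l) = 0" by (simp only:)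
  qed
  then show ?thesis using that h by blast
qed

text \<open>
  If \<open>E\<close> is invariant under a horizontal translation, the measure of \<open>osc E h\<close> does not change when \<open>h\<close> is
  translated to the left. When \<open>h\<close> vanishes far to the right, iterating the translation makes it vanish on
  any given window, so \<open>osc E h\<close> is null by continuity. By density, so is \<open>osc E g\<close> for every \<open>g\<close>.
\<close>
lemma haar_ergodic_horizontal:
  assumes M: "haar_prob M" and E: "E \<in> sets borel_X" and d: "d \<ge> 1"
    and inv: "\<And>x. x \<in> led_X \<Longrightarrow> act d 0 x \<in> E \<longleftrightarrow> x \<in> E"
  shows "measure M E = 0 \<or> measure M E = 1"
proof -
  interpret prob_space M by (rule haar_prob_space[OF M])
  obtain E' where E': "E' \<in> sets borel" "E = E' \<inter> led_X"
    using E by (auto simp: sets_restrict_space)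
  have inv_n: "act (int n * d) 0 x \<in> E \<longleftrightarrow> x \<in> E" if "x \<in> led_X" for n x
  proof (induction n)
    case (Suc n)
    have "act (int (Suc n) * d) 0 x = act d 0 (act (int n * d) 0 x)"
      by (simp add: act_act algebra_simps)
    then show ?case using inv[OF act_in_X[OF that]] Suc by simp
  qed (simp add: act_0)
  have null: "measure M (osc E g) = 0" if g: "g \<in> led_X" for g
  proof (rule ccontr)
    assume "measure M (osc E g) \<noteq> 0"
    then have pos: "measure M (osc E g) / 2 > 0" by (simp add: zero_less_measure_iff)
    obtain N where N: "\<And>h. h \<in> led_X \<Longrightarrow> vanishes_near N h
        \<Longrightarrow> measure M (osc E h) < measure M (osc E g) / 2"
    proof -
      have "osc E' h = osc E h" if "h \<in> led_X" for h
        using osc_Int_X[OF that, of E'] E'(2) by simp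
      then show ?thesis using osc_small[OF M E'(1) pos] that by auto
    qed
    obtain h K where h: "h \<in> led_X" "\<And>k l. k > K \<Longrightarrow> h (k, l) = 0" "vanishes_near N (g + h)"
      using half_supported_dense[OF g] by blast
    \<comment> \<open>a multiple of \<open>d\<close> large enough to move the support of \<open>h\<close> out of the window\<close>
    define m where "m = int (nat (K + \<bar>N\<bar> + 1)) * d"
    have "m \<ge> K + \<bar>N\<bar> + 1"
    proof -
      have "int (nat (K + \<bar>N\<bar> + 1)) * 1 \<le> m"
        unfolding m_def using d by (intro mult_left_mono) auto
      then show ?thesis by linarith
    qed
    then have "vanishes_near N (act m 0 h)"
      by (auto simp: vanishes_near_def act_def intro!: h(2))
    then have "measure M (osc E (act m 0 h)) < measure M (osc E g) / 2"
      by (intro N act_in_X h)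
    also have "measure M (osc E (act m 0 h)) = measure M (osc E h)"
      unfolding m_def by (rule osc_act[OF M E h(1) inv_n])
    finally have "measure M (osc E h) < measure M (osc E g) / 2" .
    moreover have "measure M (osc E (g + h)) < measure M (osc E g) / 2"
      by (intro N led_X_add g h)
    moreover have "measure M (osc E g) \<le> measure M (osc E (g + h)) + measure M (osc E h)"
      using osc_add_le[OF M E led_X_add[OF g h(1)] h(1)] by (simp add: add.assoc)
    ultimately show False by simp
  qed
  show ?thesis
  proof (cases "measure M E = 0")
    case False
    then have ME: "emeasure M E \<noteq> 0" by (simp add: emeasure_eq_measure)
    have E_M: "E \<in> sets M" using E by (simp add: haar_sets[OF M])
    define U where "U = uniform_measure M E"
    have "haar_prob U"
      unfolding haar_prob_def borel_prob_def
    proof (intro conjI ballI)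
      show "prob_space U"
        unfolding U_def using ME by (intro prob_space_uniform_measure)
            (auto simp: emeasure_eq_measure)
      show sets_U: "sets U = sets borel_X" by (simp add: U_def haar_sets[OF M])
      fix a assume a: "a \<in> led_X"
      have meas: "(\<lambda>x. a + x) \<in> measurable U borel_X"
        using translate_measurable[OF a] sets_U by (simp cong: measurable_cong_sets)
      have space_U: "space U = led_X" by (simp add: U_def haar_space[OF M])
      show "distr U borel_X (\<lambda>x. a + x) = U"
      proof (rule measure_eqI)
        show "sets (distr U borel_X (\<lambda>x. a + x)) = sets U" by (simp add: sets_U)
        fix B assume "B \<in> sets (distr U borel_X (\<lambda>x. a + x))"
        then have B: "B \<in> sets borel_X" by simp
        define B' where "B' = {x \<in> led_X. a + x \<in> B}"
        have B': "B' \<in> sets M" using translate_set[OF a B] by (simp add: B'_def haar_sets[OF M])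
        have "(\<lambda>x. a + x) -` B \<inter> space U = B'" by (auto simp: B'_def space_U)
        then have "emeasure (distr U borel_X (\<lambda>x. a + x)) B = emeasure U B'"
          using emeasure_distr[OF meas B] by simp
        also have "\<dots> = emeasure M (E \<inter> B') / emeasure M E"
          unfolding U_def using E_M B' by (rule emeasure_uniform_measure)
        also have "emeasure M (E \<inter> B') = emeasure M {x \<in> led_X. a + x \<in> E \<inter> B}"
        proof (rule emeasure_eq_AE)
          have "osc E a \<in> null_sets M"
            using osc_sets[OF E a] null[OF a] by (auto simp: haar_sets[OF M] emeasure_eq_measure)
          from AE_not_in[OF this] AE_space
          show "AE x in M. x \<in> E \<inter> B' \<longleftrightarrow> x \<in> {x \<in> led_X. a + x \<in> E \<inter> B}"
            by eventually_elim (auto simp: osc_def B'_def haar_space[OF M])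
          show "E \<inter> B' \<in> sets M" using E_M B' by simp
          show "{x \<in> led_X. a + x \<in> E \<inter> B} \<in> sets M"
            using translate_set[OF a, of "E \<inter> B"] E B by (simp add: haar_sets[OF M])
        qed
        also have "\<dots> = emeasure M (E \<inter> B)"
          using E B by (intro haar_translate[OF M a]) auto
        also have "\<dots> / emeasure M E = emeasure U B"
          unfolding U_def using E_M B by (intro emeasure_uniform_measure[symmetric])
              (auto simp: haar_sets[OF M])
        finally show "emeasure (distr U borel_X (\<lambda>x. a + x)) B = emeasure U B" .
      qed
    qed
    then have "U = M" using M by (rule haar_unique)
    moreover have "emeasure U E = 1"
      unfolding U_def using ME E_M by (subst emeasure_uniform_measure)
          (auto simp: emeasure_eq_measure)
    ultimately show ?thesis by (simp add: measure_def)
  qed simp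
qed

section \<open>The measure as an average of twelve images of Haar measure\<close>

lemma borel_prob_distr:
  assumes M: "borel_prob M" and f: "f \<in> measurable borel_X borel_X"
  shows "borel_prob (distr M borel_X f)"
    and "A \<in> sets borel_X \<Longrightarrow> measure (distr M borel_X f) A = measure M {x \<in> led_X. f x \<in> A}"
proof -
  have sets: "sets M = sets borel_X" and "prob_space M" using M by (auto simp: borel_prob_def)
  then interpret prob_space M by simp
  have f': "f \<in> measurable M borel_X" using f sets by (simp cong: measurable_cong_sets)
  have space: "space M = led_X" using sets_eq_imp_space_eq[OF sets] by (simp add: space_borel_X)
  show "borel_prob (distr M borel_X f)"
    using prob_space_distr[OF f'] by (simp add: borel_prob_def)
  assume A: "A \<in> sets borel_X"
  have "measure (distr M borel_X f) A = measure M (f -` A \<inter> space M)"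
    using f' A by (rule measure_distr)
  also have "f -` A \<inter> space M = {x \<in> led_X. f x \<in> A}" by (auto simp: space)
  finally show "measure (distr M borel_X f) A = measure M {x \<in> led_X. f x \<in> A}" .
qed

lemma haar_borel_prob: "haar_prob M \<Longrightarrow> borel_prob M"
  by (simp add: haar_prob_def)

lemma borel_prob_space: "borel_prob M \<Longrightarrow> space M = led_X"
  using sets_eq_imp_space_eq[of M borel_X] by (simp add: borel_prob_def space_borel_X)

lemma borel_prob_return:
  assumes "a \<in> led_X"
  shows "borel_prob (return borel_X a)"
  using assms by (auto simp: borel_prob_def space_borel_X intro: prob_space_return)

lemma emeasure_mean_of_probs:
  assumes Ms: "\<And>M. M \<in> set Ms \<Longrightarrow> borel_prob M" "Ms \<noteq> []" and A: "A \<in> sets borel_X"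
  shows "emeasure (mean_measure Ms) A = ennreal ((\<Sum>M\<leftarrow>Ms. measure M A) / real (length Ms))"
proof -
  have sum: "(\<Sum>M\<leftarrow>Ms. emeasure M A) = ennreal (\<Sum>M\<leftarrow>Ms. measure M A)"
    using Ms(1)
  proof (induction Ms)
    case (Cons M Ms)
    have "prob_space M" using Cons.prems by (auto simp: borel_prob_def)
    then interpret prob_space M .
    have "0 \<le> (\<Sum>M\<leftarrow>Ms. measure M A)" by (induction Ms) auto
    then show ?case using Cons
      by (simp add: emeasure_eq_measure)
  qed simp
  have "0 \<le> (\<Sum>M\<leftarrow>Ms. measure M A)" by (induction Ms) auto
  then have "ennreal (\<Sum>M\<leftarrow>Ms. measure M A) / ennreal (real (length Ms)) =
      ennreal ((\<Sum>M\<leftarrow>Ms. measure M A) / real (length Ms))"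
    using Ms(2) by (intro divide_ennreal) auto
  then show ?thesis
    using emeasure_mean_measure[OF _ A, of Ms] Ms(1) sum
    by (simp add: borel_prob_def ennreal_of_nat_eq_real_of_nat)
qed

lemma borel_prob_mean_measure:
  assumes Ms: "\<And>M. M \<in> set Ms \<Longrightarrow> borel_prob M" "Ms \<noteq> []"
  shows "borel_prob (mean_measure Ms)"
    and "A \<in> sets borel_X \<Longrightarrow>
      measure (mean_measure Ms) A = (\<Sum>M\<leftarrow>Ms. measure M A) / real (length Ms)"
proof -
  have space: "space (mean_measure Ms) = led_X"
    using sets_eq_imp_space_eq[OF sets_mean_measure] by (simp add: space_borel_X)
  have X: "led_X \<in> sets borel_X" using sets.top[of borel_X] by (simp add: space_borel_X)
  have "measure M led_X = 1" if "M \<in> set Ms" for M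
    using Ms(1)[OF that] borel_prob_space[of M] prob_space.prob_space[of M]
    by (simp add: borel_prob_def)
  then have "(\<Sum>M\<leftarrow>Ms. measure M led_X) = (\<Sum>M\<leftarrow>Ms. 1)"
    by (intro arg_cong[of _ _ sum_list] map_cong) auto
  then have "emeasure (mean_measure Ms) led_X = 1"
    using emeasure_mean_of_probs[OF Ms X] Ms(2) by (simp add: sum_list_triv)
  then show "borel_prob (mean_measure Ms)"
    by (auto simp: borel_prob_def space intro!: prob_spaceI)
  show "measure (mean_measure Ms) A = (\<Sum>M\<leftarrow>Ms. measure M A) / real (length Ms)"
    if "A \<in> sets borel_X"
  proof -
    have "0 \<le> (\<Sum>M\<leftarrow>Ms. measure M A)" by (induction Ms) auto
    then show ?thesis
      using emeasure_mean_of_probs[OF Ms that] unfolding measure_def[of "mean_measure Ms"] by simp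
  qed
qed

lemma singleton_set: "v \<in> led_X \<Longrightarrow> {v} \<in> sets borel_X"
proof -
  assume v: "v \<in> led_X"
  have "{x \<in> space borel_X. \<forall>p. x p = v p} \<in> sets borel_X" by measurable
  also have "{x \<in> space borel_X. \<forall>p. x p = v p} = {v}"
    using v by (auto simp: space_borel_X fun_eq_iff)
  finally show ?thesis .
qed

lemma convolution_finite_support:
  assumes M: "borel_prob M" and N: "borel_prob N"
    and F: "finite F" "F \<subseteq> led_X" "measure N F = 1" and A: "A \<in> sets borel_X"
  shows "measure (convolution_X M N) A = (\<Sum>v\<in>F. measure M {x \<in> led_X. v + x \<in> A} * measure N {v})"
    and "borel_prob (convolution_X M N)"
proof -
  have sM: "sets M = sets borel_X" and sN: "sets N = sets borel_X"
    using M N by (auto simp: borel_prob_def)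
  interpret M: prob_space M using M by (simp add: borel_prob_def)
  interpret N: prob_space N using N by (simp add: borel_prob_def)
  interpret pair_prob_space M N ..
  have plus: "(\<lambda>(x, y). x + y) \<in> measurable (M \<Otimes>\<^sub>M N) borel_X"
    using plus_measurable sets_pair_measure_cong[OF sM sN] by (simp cong: measurable_cong_sets)
  show "borel_prob (convolution_X M N)"
    unfolding convolution_X_def borel_prob_def using P.prob_space_distr[OF plus] by simp
  define Q where "Q = (\<lambda>(x, y). x + y) -` A \<inter> space (M \<Otimes>\<^sub>M N)"
  have Q: "Q \<in> sets (M \<Otimes>\<^sub>M N)" unfolding Q_def using plus A by (rule measurable_sets)
  have single: "{v} \<in> sets N" if "v \<in> F" for v
    using singleton_set F(2) that by (auto simp: sN)
  have F_N: "F \<in> sets N"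
    using sets.finite_UN[OF F(1), of "\<lambda>v. {v}" N] single by auto
  have "AE y in N. y \<in> F"
    using F(3) F_N N.prob_eq_1 by blast
  have "emeasure (convolution_X M N) A = emeasure (M \<Otimes>\<^sub>M N) Q"
    unfolding convolution_X_def Q_def using plus A by (rule emeasure_distr)
  also have "\<dots> = (\<integral>\<^sup>+y. emeasure M ((\<lambda>x. (x, y)) -` Q) \<partial>N)"
    by (rule emeasure_pair_measure_alt2[OF Q])
  also have "\<dots> = (\<integral>\<^sup>+y. (\<Sum>v\<in>F. emeasure M {x \<in> led_X. v + x \<in> A} * indicator {v} y) \<partial>N)"
  proof (rule nn_integral_cong_AE)
    show "AE y in N. emeasure M ((\<lambda>x. (x, y)) -` Q) =
        (\<Sum>v\<in>F. emeasure M {x \<in> led_X. v + x \<in> A} * indicator {v} y)"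
      using \<open>AE y in N. y \<in> F\<close>
    proof eventually_elim
      case (elim y)
      have "(\<lambda>x. (x, y)) -` Q = {x \<in> led_X. y + x \<in> A}"
        using elim F(2) by (auto simp: Q_def space_pair_measure borel_prob_space M N add.commute)
      moreover have "(\<Sum>v\<in>F. emeasure M {x \<in> led_X. v + x \<in> A} * indicator {v} y) =
          (\<Sum>v\<in>F. if v = y then emeasure M {x \<in> led_X. v + x \<in> A} else 0)"
        by (intro sum.cong) auto
      ultimately show ?case using elim F(1) by simp
    qed
  qed
  also have "\<dots> = (\<Sum>v\<in>F. emeasure M {x \<in> led_X. v + x \<in> A} * emeasure N {v})"
    using single by (subst nn_integral_sum)
        (auto intro!: sum.cong nn_integral_cmult_indicator borel_measurable_times borel_measurable_indicator)
  also have "\<dots> = (\<Sum>v\<in>F. ennreal (measure M {x \<in> led_X. v + x \<in> A} * measure N {v}))"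
    by (simp add: M.emeasure_eq_measure N.emeasure_eq_measure ennreal_mult)
  also have "\<dots> = ennreal (\<Sum>v\<in>F. measure M {x \<in> led_X. v + x \<in> A} * measure N {v})"
    by (intro sum_ennreal) auto
  finally show "measure (convolution_X M N) A
      = (\<Sum>v\<in>F. measure M {x \<in> led_X. v + x \<in> A} * measure N {v})"
    by (simp add: measure_def sum_nonneg)
qed

lemma theta_act: "theta (act a b z) = act (2 * a) (2 * b) (theta z)"
proof (rule ext, clarify)
  fix k l
  have "(k + 2 * a) div 2 = k div 2 + a" "(l + 2 * b) div 2 = l div 2 + b" by presburger+
  then show "theta (act a b z) (k, l) = act (2 * a) (2 * b) (theta z) (k, l)"
    by (simp add: theta_def act_def add.commute)
qed

lemma u_apply_cong: "(k - l) mod 3 = (k' - l') mod 3 \<Longrightarrow> u (k, l) = u (k', l')"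
  by (simp add: u_def)

lemma act_u_eqI:
  assumes "(m - n) mod 3 = (m' - n') mod 3"
  shows "act m n u = act m' n' u"
proof -
  have "(k + m - (l + n)) mod 3 = (k + m' - (l + n')) mod 3" for k l
    using mod_add_cong[OF refl assms, of "k - l"] by (simp add: algebra_simps)
  then show ?thesis
    by (auto simp: act_def fun_eq_iff intro: u_apply_cong)
qed

text \<open>
  One of the terms of the average. The parameters range over all integers, so that the invariance of \<open>\<mu>\<close>
  becomes a shift of indices in a sum over a period.
\<close>
definition weight :: "config measure \<Rightarrow> config set \<Rightarrow> int \<Rightarrow> int \<Rightarrow> int \<Rightarrow> real" where
  "weight M A i j c = measure M {z \<in> led_X. act c 0 u + act i j (theta z) \<in> A}"

lemma act_theta_set:
  assumes "A \<in> sets borel_X"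
  shows "{z \<in> led_X. act c 0 u + act i j (theta z) \<in> A} \<in> sets borel_X"
proof -
  have "(\<lambda>z. act c 0 u + act i j (theta z)) \<in> measurable borel_X borel_X"
    using measurable_compose[OF measurable_compose[OF theta_measurable act_measurable[of i j]]
        translate_measurable[OF act_in_X[OF u_in_X, of c 0]]] by simp
  from measurable_sets[OF this assms] show ?thesis
    by (simp add: vimage_def space_borel_X Int_def conj_commute)
qed

lemma mu1_borel_prob:
  assumes M: "haar_prob M"
  shows "borel_prob (mu1 M)"
    and "A \<in> sets borel_X \<Longrightarrow> measure (mu1 M) A =
      (\<Sum>i\<in>{0, 1}. \<Sum>j\<in>{0, 1}. measure M {z \<in> led_X. act i j (theta z) \<in> A}) / 4"
proof -
  define N where "N = distr M borel_X theta"
  have N: "borel_prob N"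
    unfolding N_def by (rule borel_prob_distr[OF haar_borel_prob[OF M] theta_measurable])
  have TS: "T \<circ> S = act 1 1" by (auto simp: T_eq_act S_eq_act act_act fun_eq_iff[where 'a=config])
  define L where "L = [N, distr N borel_X (act 1 0), distr N borel_X (act 0 1),
      distr N borel_X (act 1 1)]"
  have mu1: "mu1 M = mean_measure L"
    by (simp add: mu1_def L_def N_def Let_def T_eq_act[symmetric] S_eq_act[symmetric] TS[symmetric])
  have all: "borel_prob K" if "K \<in> set L" for K
    using that N borel_prob_distr(1)[OF N act_measurable] by (auto simp: L_def)
  have L: "L \<noteq> []" by (simp add: L_def)
  show "borel_prob (mu1 M)"
    unfolding mu1 by (rule borel_prob_mean_measure(1)[OF all L])
  assume A: "A \<in> sets borel_X"
  have NB: "measure N B = measure M {z \<in> led_X. theta z \<in> B}" if "B \<in> sets borel_X" for B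
    unfolding N_def by (rule borel_prob_distr(2)[OF haar_borel_prob[OF M] theta_measurable that])
  have "measure (distr N borel_X (act i j)) A = measure M {z \<in> led_X. act i j (theta z) \<in> A}"
      for i j
  proof -
    have "measure (distr N borel_X (act i j)) A = measure N {x \<in> led_X. act i j x \<in> A}"
      by (rule borel_prob_distr(2)[OF N act_measurable A])
    also have "\<dots> = measure M {z \<in> led_X. theta z \<in> {x \<in> led_X. act i j x \<in> A}}"
      by (rule NB[OF act_set[OF A]])
    also have "{z \<in> led_X. theta z \<in> {x \<in> led_X. act i j x \<in> A}} = {z \<in> led_X.
        act i j (theta z) \<in> A}"
      using theta_in_X by auto
    finally show ?thesis .
  qed
  moreover have "measure N A = measure M {z \<in> led_X. act 0 0 (theta z) \<in> A}"
    using NB[OF A] by (simp add: act_0)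
  moreover have "measure (mu1 M) A = (\<Sum>K\<leftarrow>L. measure K A) / real (length L)"
    unfolding mu1 by (rule borel_prob_mean_measure(2)[OF all L A])
  ultimately show "measure (mu1 M) A =
      (\<Sum>i\<in>{0, 1}. \<Sum>j\<in>{0, 1}. measure M {z \<in> led_X. act i j (theta z) \<in> A}) / 4"
    by (simp add: L_def)
qed

lemma act_u_distinct: "act 0 0 u \<noteq> act 1 0 u" "act 0 0 u \<noteq> act 2 0 u" "act 1 0 u \<noteq> act 2 0 u"
proof -
  have *: "act m 0 u \<noteq> act m' 0 u" if "u (k + m, 0) \<noteq> u (k + m', 0)" for m m' k
  proof
    assume "act m 0 u = act m' 0 u"
    then have "act m 0 u (k, 0) = act m' 0 u (k, 0)" by (simp only:)
    then show False using that by (simp add: act_def)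
  qed
  have v: "u (0, 0) = 0" "u (1, 0) = 1" "u (2, 0) = 1" "u (3, 0) = 0" "u (4, 0) = 1"
    by (simp_all add: u_def)
  show "act 0 0 u \<noteq> act 1 0 u" by (rule *[of 0]) (simp add: v)
  show "act 0 0 u \<noteq> act 2 0 u" by (rule *[of 0]) (simp add: v)
  show "act 1 0 u \<noteq> act 2 0 u" by (rule *[of 2]) (simp add: v)
qed

lemma nu_properties:
  shows "borel_prob nu" and "c \<in> {0, 1, 2} \<Longrightarrow> measure nu {act c 0 u} = 1 / 3"
    and "measure nu {act 0 0 u, act 1 0 u, act 2 0 u} = 1"
proof -
  define L where "L = [return borel_X (act 0 0 u), return borel_X (act 1 0 u),
      return borel_X (act 2 0 u)]"
  have nu: "nu = mean_measure L"
    using act_u_eqI[of 0 1 2 0] by (simp add: nu_def L_def T_eq_act S_eq_act act_0)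
  have all: "borel_prob K" if "K \<in> set L" for K
    using that borel_prob_return[OF act_in_X[OF u_in_X]] by (auto simp: L_def)
  have L: "L \<noteq> []" by (simp add: L_def)
  show "borel_prob nu"
    unfolding nu by (rule borel_prob_mean_measure(1)[OF all L])
  have eq: "measure nu A
      = (indicator A (act 0 0 u) + indicator A (act 1 0 u) + indicator A (act 2 0 u)) / 3"
    if A: "A \<in> sets borel_X" for A
  proof -
    have "measure nu A = (\<Sum>K\<leftarrow>L. measure K A) / real (length L)"
      unfolding nu by (rule borel_prob_mean_measure(2)[OF all L A])
    then show ?thesis by (simp add: L_def measure_return[OF A])
  qed
  have s: "{act c 0 u} \<in> sets borel_X" for c by (rule singleton_set[OF act_in_X[OF u_in_X]])
  show "c \<in> {0, 1, 2} \<Longrightarrow> measure nu {act c 0 u} = 1 / 3"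
    using act_u_distinct by (auto simp: eq[OF s])
  have "{act 0 0 u} \<union> {act 1 0 u} \<union> {act 2 0 u} \<in> sets borel_X"
    by (intro sets.Un s)
  then have "{act 0 0 u, act 1 0 u, act 2 0 u} \<in> sets borel_X" by (simp add: insert_commute)
  then show "measure nu {act 0 0 u, act 1 0 u, act 2 0 u} = 1" by (simp add: eq)
qed

lemma mu_formula:
  assumes M: "haar_prob M"
  shows "borel_prob (convolution_X (mu1 M) nu)"
    and "A \<in> sets borel_X \<Longrightarrow> measure (convolution_X (mu1 M) nu) A =
      (\<Sum>c\<in>{0, 1, 2}. \<Sum>i\<in>{0, 1}. \<Sum>j\<in>{0, 1}. weight M A i j c) / 12"
proof -
  define F where "F = {act 0 0 u, act 1 0 u, act 2 0 u}"
  have X: "act c 0 u \<in> led_X" for c by (rule act_in_X[OF u_in_X])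
  have F: "finite F" "F \<subseteq> led_X" "measure nu F = 1"
    unfolding F_def by (simp, simp add: X, rule nu_properties(3))
  note conv = convolution_finite_support[OF mu1_borel_prob(1)[OF M] nu_properties(1) F]
  show "borel_prob (convolution_X (mu1 M) nu)"
    using conv(2)[OF sets.empty_sets] .
  assume A: "A \<in> sets borel_X"
  have *: "measure (mu1 M) {x \<in> led_X. act c 0 u + x \<in> A}
      = (\<Sum>i\<in>{0, 1}. \<Sum>j\<in>{0, 1}. weight M A i j c) / 4" for c
  proof -
    have "{z \<in> led_X. act i j (theta z) \<in> {x \<in> led_X. act c 0 u + x \<in> A}} =
        {z \<in> led_X. act c 0 u + act i j (theta z) \<in> A}" for i j
      using act_in_X[OF theta_in_X] by blast
    then show ?thesis
      using mu1_borel_prob(2)[OF M translate_set[OF X A], of c] by (simp only: weight_def)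
  qed
  have "measure (convolution_X (mu1 M) nu) A =
      (\<Sum>v\<in>F. measure (mu1 M) {x \<in> led_X. v + x \<in> A} * measure nu {v})"
    by (rule conv(1)[OF A])
  also have "F = (\<lambda>c. act c 0 u) ` {0, 1, 2}" by (simp add: F_def)
  also have "(\<Sum>v\<in>(\<lambda>c.
      act c 0 u) ` {0, 1, 2}. measure (mu1 M) {x \<in> led_X. v + x \<in> A} * measure nu {v}) =
      (\<Sum>c\<in>{0, 1, 2}. measure (mu1 M) {x \<in> led_X. act c 0 u + x \<in> A} * measure nu {act c 0 u})"
    using act_u_distinct by (subst sum.reindex) (auto simp: inj_on_def)
  also have "\<dots> = (\<Sum>c\<in>{0, 1, 2}. (\<Sum>i\<in>{0, 1}. \<Sum>j\<in>{0, 1}. weight M A i j c) / 12)"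
  proof (rule sum.cong[OF refl])
    fix c :: int assume "c \<in> {0, 1, 2}"
    from nu_properties(2)[OF this] show "measure (mu1 M) {x \<in> led_X. act c 0 u + x \<in> A} *
        measure nu {act c 0 u} = (\<Sum>i\<in>{0, 1}. \<Sum>j\<in>{0, 1}. weight M A i j c) / 12"
      by (simp add: *)
  qed
  finally show "measure (convolution_X (mu1 M) nu) A =
      (\<Sum>c\<in>{0, 1, 2}. \<Sum>i\<in>{0, 1}. \<Sum>j\<in>{0, 1}. weight M A i j c) / 12"
    by (simp only: sum_divide_distrib)
qed

lemma periodic_mod:
  fixes f :: "int \<Rightarrow> 'a"
  assumes "\<And>i. f (i + d) = f i"
  shows "f i = f (i mod d)"
proof -
  have "f (r + q * d) = f r" for q r
  proof (induction q rule: int_induct[of _ 0])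
    case (step1 q)
    then show ?case using assms[of "r + q * d"] by (simp add: algebra_simps)
  next
    case (step2 q)
    then show ?case using assms[of "r + (q - 1) * d"] by (simp add: algebra_simps)
  qed simp
  from this[of "i mod d" "i div d"] show ?thesis by simp
qed

lemma sum_period_2:
  fixes f :: "int \<Rightarrow> real"
  assumes "\<And>i. f (i + 2) = f i"
  shows "(\<Sum>i\<in>{0, 1}. f (i + m)) = (\<Sum>i\<in>{0, 1}. f i)"
proof -
  note p = periodic_mod[of f 2, OF assms]
  have "m mod 2 = 0 \<and> (1 + m) mod 2 = 1 \<or> m mod 2 = 1 \<and> (1 + m) mod 2 = 0" by presburger
  then show ?thesis using p[of m] p[of "1 + m"] by auto
qed

lemma sum_period_3:
  fixes f :: "int \<Rightarrow> real"
  assumes "\<And>i. f (i + 3) = f i"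
  shows "(\<Sum>i\<in>{0, 1, 2}. f (i + m)) = (\<Sum>i\<in>{0, 1, 2}. f i)"
proof -
  note p = periodic_mod[of f 3, OF assms]
  have "m mod 3 = 0 \<and> (1 + m) mod 3 = 1 \<and> (2 + m) mod 3 = 2 \<or>
    m mod 3 = 1 \<and> (1 + m) mod 3 = 2 \<and> (2 + m) mod 3 = 0 \<or>
    m mod 3 = 2 \<and> (1 + m) mod 3 = 0 \<and> (2 + m) mod 3 = 1" by presburger
  then show ?thesis using p[of m] p[of "1 + m"] p[of "2 + m"] by auto
qed

text \<open>
  Translating \<open>theta z\<close> by two units amounts to translating \<open>z\<close> by one, which preserves Haar measure.
\<close>
lemma weight_period:
  assumes M: "haar_prob M" and A: "A \<in> sets borel_X"
  shows "weight M A (i + 2) j c = weight M A i j c"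
    and "weight M A i (j + 2) c = weight M A i j c"
    and "weight M A i j (c + 3) = weight M A i j c"
proof -
  have shift: "weight M A (i + 2 * a) (j + 2 * b) c = weight M A i j c" for a b
  proof -
    have "{z \<in> led_X. act a b z \<in> {z \<in> led_X. act c 0 u + act i j (theta z) \<in> A}} =
        {z \<in> led_X. act c 0 u + act (i + 2 * a) (j + 2 * b) (theta z) \<in> A}"
      by (auto simp: act_in_X theta_act act_act)
    then show ?thesis
      using haar_act_measure[OF M act_theta_set[OF A], of a b c i j] by (simp add: weight_def)
  qed
  show "weight M A (i + 2) j c = weight M A i j c" using shift[of 1 0] by simp
  show "weight M A i (j + 2) c = weight M A i j c" using shift[of 0 1] by simp
  show "weight M A i j (c + 3) = weight M A i j c"
    using act_u_eqI[of "c + 3" 0 c 0] by (simp add: weight_def)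
qed

lemma mu_invariant:
  assumes M: "haar_prob M"
  shows "invariant_measure (convolution_X (mu1 M) nu)"
  unfolding invariant_measure_def
proof (intro allI)
  fix m n
  define \<mu> where "\<mu> = convolution_X (mu1 M) nu"
  have \<mu>: "borel_prob \<mu>" unfolding \<mu>_def by (rule mu_formula(1)[OF M])
  then have sets: "sets \<mu> = sets borel_X" by (simp add: borel_prob_def)
  interpret prob_space \<mu> using \<mu> by (simp add: borel_prob_def)
  have d: "borel_prob (distr \<mu> borel_X (act m n))"
      by (rule borel_prob_distr(1)[OF \<mu> act_measurable])
  interpret d: prob_space "distr \<mu> borel_X (act m n)" using d by (simp add: borel_prob_def)
  show "distr (convolution_X (mu1 M) nu) borel_X (act m n) = convolution_X (mu1 M) nu"
    unfolding \<mu>_def[symmetric]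
  proof (rule measure_eqI)
    fix A assume "A \<in> sets (distr \<mu> borel_X (act m n))"
    then have A: "A \<in> sets borel_X" by simp
    have w: "weight M {x \<in> led_X. act m n x \<in> A} i j c
        = weight M A (i + m) (j + n) (c + (m - n))" for i j c
    proof -
      have "act m n (act c 0 u + act i j (theta z)) = act (c + (m - n)) 0 u +
          act (i + m) (j + n) (theta z)" for z
        using act_u_eqI[of "c + m" n "c + (m - n)" 0]
            by (simp add: act_add act_act add_diff_eq add.commute)
      then have "{z \<in> led_X. act c 0 u + act i j (theta z) \<in> {x \<in> led_X. act m n x \<in> A}} =
          {z \<in> led_X. act (c + (m - n)) 0 u + act (i + m) (j + n) (theta z) \<in> A}"
        by (auto intro!: led_X_add act_in_X u_in_X theta_in_X)
      then show ?thesis by (simp add: weight_def)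
    qed
    have "measure (distr \<mu> borel_X (act m n)) A = measure \<mu> {x \<in> led_X. act m n x \<in> A}"
      by (rule borel_prob_distr(2)[OF \<mu> act_measurable A])
    also have "\<dots>
        = (\<Sum>c\<in>{0, 1, 2}. \<Sum>i\<in>{0, 1}. \<Sum>j\<in>{0, 1}. weight M A (i + m) (j + n) (c + (m - n))) / 12"
      unfolding \<mu>_def using mu_formula(2)[OF M act_set[OF A, of m n]] by (simp only: w)
    also have "(\<Sum>c\<in>{0, 1, 2}. \<Sum>i\<in>{0, 1}. \<Sum>j\<in>{0, 1}. weight M A (i + m) (j + n) (c + (m - n))) =
        (\<Sum>c\<in>{0, 1, 2}. \<Sum>i\<in>{0, 1}. \<Sum>j\<in>{0, 1}. weight M A (i + m) (j + n) c)"
      by (rule sum_period_3) (simp only: weight_period[OF M A])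
    also have "\<dots> = (\<Sum>c\<in>{0, 1, 2}. \<Sum>i\<in>{0, 1}. \<Sum>j\<in>{0, 1}. weight M A i (j + n) c)"
      by (intro sum.cong refl sum_period_2) (simp only: weight_period[OF M A])
    also have "\<dots> = (\<Sum>c\<in>{0, 1, 2}. \<Sum>i\<in>{0, 1}. \<Sum>j\<in>{0, 1}. weight M A i j c)"
      by (intro sum.cong refl sum_period_2) (simp only: weight_period[OF M A])
    also have "\<dots> / 12 = measure \<mu> A"
      unfolding \<mu>_def by (rule mu_formula(2)[OF M A, symmetric])
    finally show "emeasure (distr \<mu> borel_X (act m n)) A = emeasure \<mu> A"
      by (simp add: emeasure_eq_measure d.emeasure_eq_measure)
  qed (simp add: sets)
qed

text \<open>
  For an invariant set the terms of the average depend only on \<open>c - i + j\<close>. As functions of this number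
  they have the periods \<open>2\<close> and \<open>3\<close>, hence the twelve terms are equal.
\<close>
lemma mu_of_invariant:
  assumes M: "haar_prob M" and A: "A \<in> sets borel_X"
    and inv: "\<And>m n x. x \<in> led_X \<Longrightarrow> act m n x \<in> A \<longleftrightarrow> x \<in> A"
  shows "measure (convolution_X (mu1 M) nu) A = measure M {z \<in> led_X. u + theta z \<in> A}"
proof -
  define f where "f c = weight M A 0 0 c" for c
  have w: "weight M A i j c = f (c - i + j)" for i j c
  proof -
    have "act c 0 u + act i j (theta z) = act i j (act (c - i + j) 0 u + act 0 0 (theta z))" for z
      using act_u_eqI[of "i + (c - i + j)" j c 0] by (simp add: act_add act_act)
    then have "(act c 0 u + act i j (theta z) \<in> A) = (act (c - i + j) 0 u + act 0 0 (theta z) \<in> A)"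
      if "z \<in> led_X" for z
      using inv[OF led_X_add[OF act_in_X[OF u_in_X] act_in_X[OF theta_in_X[OF that]]]] by simp
    then show ?thesis unfolding f_def weight_def by (intro arg_cong[of _ _ "measure M"]) auto
  qed
  have "f (c + 2) = f c" for c
    using w[of 0 2 c] weight_period(2)[OF M A, of 0 0 c] by (simp add: f_def)
  moreover have "f (c + 3) = f c" for c
    unfolding f_def by (rule weight_period(3)[OF M A])
  \<comment> \<open>as \<open>c + 3 = (c + 1) + 2\<close>\<close>
  ultimately have "f (c + 1) = f c" for c
    by (metis add.assoc one_plus_numeral semiring_norm(3))
  from periodic_mod[of f 1, OF this] have f: "f c = f 0" for c by simp
  have "measure (convolution_X (mu1 M) nu) A = f 0"
    unfolding mu_formula(2)[OF M A] w by (subst f) simp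
  then show ?thesis
    by (simp add: f_def weight_def act_0)
qed

text \<open>
  If \<open>A\<close> is invariant, the set of \<open>z\<close> with \<open>u + theta z \<in> A\<close> is invariant under \<open>act 3 0\<close>, because
  \<open>act 6 0\<close> fixes \<open>u\<close>.
\<close>
lemma mu_ergodic:
  assumes M: "haar_prob M"
  shows "ergodic (convolution_X (mu1 M) nu)"
  unfolding ergodic_def
proof (intro ballI impI)
  fix A assume "A \<in> sets (convolution_X (mu1 M) nu)" and inv: "invariant_set A"
  then have A: "A \<in> sets borel_X" by (simp add: convolution_X_def)
  have inv': "act m n x \<in> A \<longleftrightarrow> x \<in> A" for m n x
  proof
    assume "act m n x \<in> A"
    then have "act (- m) (- n) (act m n x) \<in> A" using inv unfolding invariant_set_def by blast
    then show "x \<in> A" by (simp add: act_act act_0)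
  qed (use inv in \<open>auto simp: invariant_set_def\<close>)
  define E where "E = {z \<in> led_X. u + theta z \<in> A}"
  have E: "E \<in> sets borel_X"
    using act_theta_set[OF A, of 0 0 0] by (simp add: E_def act_0)
  have "measure M E = 0 \<or> measure M E = 1"
  proof (rule haar_ergodic_horizontal[OF M E, of 3])
    fix z assume z: "z \<in> led_X"
    have "u + theta (act 3 0 z) = act 6 0 (u + theta z)"
      using act_u_eqI[of 6 0 0 0] by (simp add: act_add theta_act act_0)
    then show "act 3 0 z \<in> E \<longleftrightarrow> z \<in> E" using z by (simp add: E_def act_in_X inv')
  qed simp
  then show "measure (convolution_X (mu1 M) nu) A = 0 \<or> measure (convolution_X (mu1 M) nu) A = 1"
    using mu_of_invariant[OF M A] inv' by (simp add: E_def)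
qed

section \<open>Measurability of the set of points with infinitely many antecedents\<close>

lemma led_sigma_in_X: "x \<in> led_X \<Longrightarrow> led_sigma x \<in> led_X"
  by (simp add: led_sigma_def T_eq_act S_eq_act act_in_X)

lemma led_sigma_measurable: "led_sigma \<in> measurable borel_X borel_X"
proof (rule measurable_to_borel_X)
  fix p :: "int \<times> int"
  have "Measurable.pred borel_X (\<lambda>x. x (1, 0) = 1)" by measurable
  moreover have "(\<lambda>x. act 1 0 x p) \<in> borel_measurable borel_X" "(\<lambda>x.
      act 0 1 x p) \<in> borel_measurable borel_X"
    by (cases p; simp add: act_def)+
  ultimately have "(\<lambda>x. if x (1, 0) = 1 then act 1 0 x p else
      act 0 1 x p) \<in> borel_measurable borel_X"
    by (intro measurable_If) (auto simp: pred_def)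
  also have "?this \<longleftrightarrow> (\<lambda>x. led_sigma x p) \<in> borel_measurable borel_X"
    by (intro measurable_cong)
        (auto simp: led_sigma_def led_Y_def T_eq_act S_eq_act act_in_X space_borel_X, simp_all add: act_def)
  finally show "(\<lambda>x. led_sigma x p) \<in> borel_measurable borel_X" .
qed (simp add: space_borel_X led_sigma_in_X)

lemma measurable_eq_pred:
  assumes f: "f \<in> measurable borel_X borel_X" and g: "g \<in> measurable borel_X borel_X"
  shows "Measurable.pred borel_X (\<lambda>x. f x = g x)"
proof -
  have pred: "Measurable.pred borel_X (\<lambda>x. h x p = c)" if "h \<in> measurable borel_X borel_X" for h p c
    using measurable_compose[OF that coordinate_pred] .
  have bit_eq: "a = b \<longleftrightarrow> a = 0 \<and> b = 0 \<or> a = 1 \<and> b = 1" for a b :: bit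
    by (cases a; cases b) auto
  have "f x = g x \<longleftrightarrow> (\<forall>p. f x p = 0 \<and> g x p = 0 \<or> f x p = 1 \<and> g x p = 1)" for x
    unfolding fun_eq_iff by (rule all_cong1) (rule bit_eq)
  then show ?thesis
    using f g by (simp only:) (intro pred_intros_countable pred_intros_logic pred)
qed

text \<open>
  With a countable index type this expresses infinity by countably many conditions. It covers repeated
  values, which do occur at periodic configurations.
\<close>
lemma infinite_image_iff:
  "infinite (f ` {i. R i}) \<longleftrightarrow> (\<forall>L. \<exists>i. R i \<and> (\<forall>j\<in>set L. f i \<noteq> f j))"
proof
  assume inf: "infinite (f ` {i. R i})"
  show "\<forall>L. \<exists>i. R i \<and> (\<forall>j\<in>set L. f i \<noteq> f j)"
  proof (rule ccontr)
    assume "\<not> (\<forall>L. \<exists>i. R i \<and> (\<forall>j\<in>set L. f i \<noteq> f j))"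
    then obtain L where "\<And>i. R i \<Longrightarrow> \<exists>j\<in>set L. f i = f j" by blast
    then have "f ` {i. R i} \<subseteq> f ` set L" by blast
    then show False using inf finite_subset by blast
  qed
next
  assume avoid: "\<forall>L. \<exists>i. R i \<and> (\<forall>j\<in>set L. f i \<noteq> f j)"
  show "infinite (f ` {i. R i})"
  proof
    assume "finite (f ` {i. R i})"
    then obtain F where F: "F \<subseteq> {i. R i}" "finite F" "f ` {i. R i} = f ` F"
      by (meson finite_subset_image subset_refl)
    obtain L where "set L = F" using finite_list[OF F(2)] by blast
    then show False using avoid F(3) by blast
  qed
qed

lemma led_Z_sets: "led_Z \<in> sets borel_X"
proof -
  define b where "b = (\<lambda>(i :: nat \<times> nat) x. act (- int (fst i)) (- int (snd i)) x)"
  define R where "R = (\<lambda>i x. fst i + snd i \<ge> 1 \<and> b i x (0, 0) = 1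
      \<and> (led_sigma ^^ (fst i + snd i)) (b i x) = x)"
  have ante: "sigma_antecedents x = (\<lambda>i. b i x) ` {i. R i x}" if x: "x \<in> led_X" for x
  proof (intro set_eqI iffI)
    fix y assume "y \<in> sigma_antecedents x"
    then obtain n where n: "n \<ge> 1" "y \<in> led_Y" "(led_sigma ^^ n) y = x"
      by (auto simp: sigma_antecedents_def)
    then obtain k l where kl: "k + l = n" "x = act (int k) (int l) y"
      using funpow_sigma_eq_act by blast
    then have "y = b (k, l) x" by (simp add: b_def act_act act_0)
    then show "y \<in> (\<lambda>i. b i x) ` {i. R i x}"
      using n kl(1) by (intro image_eqI[of _ _ "(k, l)"]) (auto simp: R_def led_Y_def)
  next
    fix y assume "y \<in> (\<lambda>i. b i x) ` {i. R i x}"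
    then obtain i where i: "y = b i x" "R i x" by blast
    then have "y \<in> led_Y" using x by (auto simp: R_def b_def led_Y_def act_in_X)
    then show "y \<in> sigma_antecedents x"
      using i by (auto simp: sigma_antecedents_def R_def)
  qed
  have b: "b i \<in> measurable borel_X borel_X" for i
    unfolding b_def by (rule act_measurable)
  have sigma_n: "led_sigma ^^ n \<in> measurable borel_X borel_X" for n
  proof (induction n)
    case (Suc n)
    then show ?case using measurable_comp[OF Suc led_sigma_measurable] by (simp add: comp_def)
  qed (simp add: id_def)
  have R1: "Measurable.pred borel_X (\<lambda>x. b i x (0, 0) = 1)" for i
    using measurable_compose[OF b coordinate_pred] .
  have R2: "Measurable.pred borel_X (\<lambda>x. (led_sigma ^^ n) (b i x) = x)" for i n
    by (rule measurable_eq_pred[OF measurable_compose[OF b sigma_n] measurable_ident_sets[OF refl, unfolded id_def]])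
  have R: "Measurable.pred borel_X (\<lambda>x. R i x)" for i
    unfolding R_def by (intro pred_intros_conj1' pred_intros_logic R1 R2)
  have eq: "Measurable.pred borel_X (\<lambda>x. b i x = b j x)" for i j
    by (rule measurable_eq_pred[OF b b])
  have "Measurable.pred borel_X (\<lambda>x. x (0, 0) = 1 \<and> (\<forall>L. \<exists>i. R i x \<and> (\<forall>j\<in>set L. b i x \<noteq> b j x)))"
    by (intro pred_intros_countable pred_intros_countable_bounded pred_intros_logic coordinate_pred R eq)
  then have "{x \<in> space borel_X. x (0, 0) = 1 \<and> (\<forall>L. \<exists>i. R i x
      \<and> (\<forall>j\<in>set L. b i x \<noteq> b j x))} \<in> sets borel_X"
    by (simp only: pred_def)
  also have "{x \<in> space borel_X. x (0, 0) = 1 \<and> (\<forall>L. \<exists>i. R i x \<and> (\<forall>j\<in>set L. b i x \<noteq> b j x))}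
      = led_Z"
  proof -
    have "infinite (sigma_antecedents x) \<longleftrightarrow> (\<forall>L. \<exists>i. R i x \<and> (\<forall>j\<in>set L. b i x \<noteq> b j x))"
      if "x \<in> led_X" for x
      by (simp only: ante[OF that] infinite_image_iff)
    then show ?thesis
      unfolding led_Z_def led_Y_def space_borel_X by blast
  qed
  finally show ?thesis .
qed

section \<open>Tame configurations have full measure\<close>

definition ribbon_set :: "config set" where
  "ribbon_set = {x \<in> led_X. \<exists>m n. tame (act m n x)}"

lemma ribbon_set_sets: "ribbon_set \<in> sets borel_X"
proof -
  have 1: "Measurable.pred borel_X (\<lambda>x. \<forall>m n. (m, n) \<noteq> (0, 0) \<longrightarrow> (\<exists>p. x (fst p + m, snd p + n) \<noteq> x p))"
    by (intro pred_intros_countable pred_intros_imp' pred_intros_logic coordinates_eq_pred)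
  have 2: "Measurable.pred borel_X (\<lambda>x. \<forall>k l. x (2 * k, 2 * l) = u (2 * k, 2 * l))"
    by (intro pred_intros_countable pred_intros_logic coordinate_pred)
  have 3: "Measurable.pred borel_X (\<lambda>x. \<forall>D N. (\<exists>b\<in>{N..}. x (2 * (b + 3 * D + 2) + 1, 2 * b + 1)
      = 0) \<and>
         (\<exists>b\<in>{..N}. x (2 * (b + 3 * D + 2) + 1, 2 * b + 1) = 0))"
    by (intro pred_intros_countable pred_intros_countable_bounded pred_intros_logic coordinate_pred)
  have "Measurable.pred borel_X (\<lambda>x. (\<forall>m n. (m, n) \<noteq> (0, 0) \<longrightarrow> (\<exists>p. x (fst p + m, snd p + n) \<noteq> x p)) \<and>
      (\<forall>k l. x (2 * k, 2 * l) = u (2 * k, 2 * l)) \<and>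
      (\<forall>D N. (\<exists>b\<in>{N..}. x (2 * (b + 3 * D + 2) + 1, 2 * b + 1) = 0) \<and>
         (\<exists>b\<in>{..N}. x (2 * (b + 3 * D + 2) + 1, 2 * b + 1) = 0)))" (is "Measurable.pred _ ?P")
    by (rule pred_intros_logic(3)[OF 1 pred_intros_logic(3)[OF 2 3]])
  then have "{x \<in> space borel_X. ?P x} \<in> sets borel_X" by (simp only: pred_def)
  also have "{x \<in> space borel_X. ?P x} = {x. tame x}"
  proof -
    have act_apply: "act m n x p = x (fst p + m, snd p + n)" for m n x p
      by (cases p) (simp add: act_def)
    have aperiodic_iff: "aperiodic x
        \<longleftrightarrow> (\<forall>m n. (m, n) \<noteq> (0, 0) \<longrightarrow> (\<exists>p. x (fst p + m, snd p + n) \<noteq> x p))" for x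
      unfolding aperiodic_def fun_eq_iff act_apply prod.inject by blast
    show ?thesis
      by (simp only: tame_def aperiodic_iff space_borel_X Bex_def atLeast_iff atMost_iff)
  qed
  finally have "{x. tame x} \<in> sets borel_X" .
  then have "(\<Union>m n. {x \<in> led_X. act m n x \<in> {x. tame x}}) \<in> sets borel_X"
    by (intro sets.countable_UN'' countableI_type act_set)
  also have "(\<Union>m n. {x \<in> led_X. act m n x \<in> {x. tame x}}) = ribbon_set"
    by (auto simp: ribbon_set_def)
  finally show ?thesis .
qed

lemma act_ribbon_set: "act m n x \<in> ribbon_set \<longleftrightarrow> x \<in> ribbon_set"
proof -
  have *: "act m n x \<in> ribbon_set" if x: "x \<in> ribbon_set" for m n x
  proof -
    obtain i j where "x \<in> led_X" "tame (act i j x)" using x by (auto simp: ribbon_set_def)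
    then have "tame (act (i - m) (j - n) (act m n x))" by (simp add: act_act)
    then show ?thesis using \<open>x \<in> led_X\<close> by (auto simp: ribbon_set_def act_in_X)
  qed
  show ?thesis
    using *[of x m n] *[of "act m n x" "- m" "- n"] by (auto simp: act_act act_0)
qed

lemma invariant_setI:
  assumes "\<And>m n x. act m n x \<in> A \<longleftrightarrow> x \<in> A"
  shows "invariant_set A"
  unfolding invariant_set_def
proof (intro allI equalityI subsetI)
  fix m n x assume "x \<in> A"
  then have "act (- m) (- n) x \<in> A" using assms by blast
  moreover have "x = act m n (act (- m) (- n) x)" by (simp add: act_act act_0)
  ultimately show "x \<in> act m n ` A" by blast
qed (use assms in auto)

text \<open>
  The parity classes of positions separate \<open>u\<close> from \<open>theta z\<close>. A period \<open>(m, n)\<close> of \<open>u + theta z\<close> gives the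
  period \<open>(6 * m, 6 * n)\<close>, which is one of \<open>u\<close> as well, hence the period \<open>(3 * m, 3 * n)\<close> of \<open>z\<close>.
\<close>
lemma haar_AE_tame:
  assumes M: "haar_prob M"
  shows "AE z in M. tame (u + theta z)"
proof -
  have diag: "AE z in M. \<exists>k\<in>K. z (k, k - c) = 1" if "infinite K" for K c
    by (rule haar_AE_one_on_columns[OF M that])
  have "AE z in M. \<forall>D N. (\<exists>k\<in>{N..}. z (k, k - (3 * D + 2)) = 1)
      \<and> (\<exists>k\<in>{..N}. z (k, k - (3 * D + 2)) = 1)"
    by (simp only: AE_all_countable AE_conj_iff) (intro allI conjI diag; simp add: infinite_Ici infinite_Iic)
  moreover have "AE z in M. \<forall>m n. (m, n) \<noteq> (0, 0) \<longrightarrow> act m n z \<noteq> z"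
    unfolding AE_all_countable
  proof (intro allI)
    fix m n :: int
    show "AE z in M. (m, n) \<noteq> (0, 0) \<longrightarrow> act m n z \<noteq> z"
      using haar_AE_not_periodic[OF M, of m n] by (cases "(m, n) = (0, 0)") auto
  qed
  moreover have "AE z in M. z \<in> led_X" using AE_space[of M] by (simp add: haar_space[OF M])
  ultimately show ?thesis
  proof eventually_elim
    case (elim z)
    have "aperiodic (u + theta z)"
      unfolding aperiodic_def
    proof (intro allI impI)
      fix m n assume per: "act m n (u + theta z) = u + theta z"
      define y where "y = u + theta z"
      have "act (int i * m) (int i * n) y = y" for i
      proof (induction i)
        case (Suc i)
        have "act (int (Suc i) * m) (int (Suc i) * n) y = act m n (act (int i * m) (int i * n) y)"
          by (simp add: act_act algebra_simps)
        then show ?case by (simp only: Suc per[folded y_def])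
      qed (simp add: act_0)
      from this[of 6] have "act (6 * m) (6 * n) u + act (6 * m) (6 * n) (theta z) = u + theta z"
        by (simp add: y_def act_add)
      moreover have "act (6 * m) (6 * n) u = u"
      proof -
        have "(6 * m - 6 * n) mod 3 = 0" by presburger
        then show ?thesis using act_u_eqI[of "6 * m" "6 * n" 0 0] by (simp add: act_0)
      qed
      ultimately have th: "theta (act (3 * m) (3 * n) z) = theta z" by (simp add: theta_act)
      have "act (3 * m) (3 * n) z p = z p" for p
        using fun_cong[OF th, of "(2 * fst p + 1, 2 * snd p)"] by (simp add: theta_simps)
      then have "act (3 * m) (3 * n) z = z" by (rule ext)
      then have "(3 * m, 3 * n) = (0, 0)" using elim(2) by blast
      then show "m = 0 \<and> n = 0" by simp
    qed
    moreover have "(\<exists>b\<ge>N. (u + theta z) (2 * (b + 3 * D + 2) + 1, 2 * b + 1) = 0) \<and>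
        (\<exists>b\<le>N. (u + theta z) (2 * (b + 3 * D + 2) + 1, 2 * b + 1) = 0)" for N D
    proof -
      have zero: "(u + theta z) (2 * (b + 3 * D + 2) + 1, 2 * b + 1) = 0"
        if "z (k, k - (3 * D + 2)) = 1" "b = k - (3 * D + 2)" for b k
      proof -
        have "(2 * (b + 3 * D + 2) + 1 - (2 * b + 1)) mod 3 \<noteq> 0" by presburger
        then have "u (2 * (b + 3 * D + 2) + 1, 2 * b + 1) = 1" by (simp add: u_def)
        moreover have "theta z (2 * (b + 3 * D + 2) + 1, 2 * b + 1) = z (b + 3 * D + 2, b)"
          by (rule theta_simps)
        moreover have "z (b + 3 * D + 2, b) = 1" using that by simp
        ultimately show ?thesis by (simp only: plus_fun_apply) simp
      qed
      obtain k where k: "k \<in> {N + (3 * D + 2)..}" "z (k, k - (3 * D + 2)) = 1"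
        using elim(1) by blast
      obtain k' where k': "k' \<in> {..N + (3 * D + 2)}" "z (k', k' - (3 * D + 2)) = 1"
        using elim(1) by blast
      have "k - (3 * D + 2) \<ge> N" "k' - (3 * D + 2) \<le> N" using k k' by simp_all
      with zero[OF k(2) refl] zero[OF k'(2) refl] show ?thesis by blast
    qed
    moreover have "u + theta z \<in> led_X" using elim(3) by (intro led_X_add u_in_X theta_in_X)
    moreover have "(u + theta z) (2 * k, 2 * l) = u (2 * k, 2 * l)" for k l
      by (simp add: theta_simps)
    ultimately show ?case
      by (simp only: tame_def simp_thms)
  qed
qed

lemma mu_ribbon_set:
  assumes M: "haar_prob M"
  shows "measure (convolution_X (mu1 M) nu) ribbon_set = 1"
proof -
  interpret prob_space M by (rule haar_prob_space[OF M])
  define E where "E = {z \<in> led_X. u + theta z \<in> ribbon_set}"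
  have E: "E \<in> sets M"
    using act_theta_set[OF ribbon_set_sets, of 0 0 0] by (simp add: E_def act_0 haar_sets[OF M])
  have "AE z in M. z \<in> E"
    using haar_AE_tame[OF M] AE_space
  proof eventually_elim
    case (elim z)
    then have "z \<in> led_X" by (simp add: haar_space[OF M])
    moreover have "u + theta z \<in> led_X" using elim by (simp add: tame_def)
    moreover have "tame (act 0 0 (u + theta z))" using elim by (simp add: act_0)
    ultimately show ?case unfolding E_def ribbon_set_def by blast
  qed
  then have "measure M E = 1" using E prob_eq_1 by blast
  then show ?thesis
    using mu_of_invariant[OF M ribbon_set_sets act_ribbon_set] by (simp add: E_def)
qed

section \<open>Absence of atoms\<close>

text \<open>
  If \<open>A\<close> had no measurable subset of strictly intermediate measure, for each position one of the two
  values would be taken almost nowhere in \<open>A\<close>. Discarding these null sets leaves at most one point.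
\<close>
lemma atomlessI:
  assumes M: "borel_prob M" and null: "\<And>x. x \<in> led_X \<Longrightarrow> measure M {x} = 0"
  shows "atomless M"
  unfolding atomless_def
proof (intro ballI impI)
  fix A assume A: "A \<in> sets M" and pos: "emeasure M A > 0"
  interpret prob_space M using M by (simp add: borel_prob_def)
  have sets: "sets M = sets borel_X" using M by (simp add: borel_prob_def)
  show "\<exists>B\<in>sets M. B \<subseteq> A \<and> 0 < emeasure M B \<and> emeasure M B < emeasure M A"
  proof (rule ccontr)
    assume no: "\<not> ?thesis"
    define C where "C p c = A \<inter> {x \<in> space borel_X. x p = c}" for p c
    have "{x \<in> space borel_X. x p = c} \<in> sets M" for p c
      unfolding sets using coordinate_pred by (simp only: pred_def)
    then have C: "C p c \<in> sets M" "C p c \<subseteq> A" for p c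
      unfolding C_def using A by (blast intro: sets.Int, blast)
    have "\<exists>c. measure M (C p c) = 0" for p
    proof (rule ccontr)
      assume "\<not> ?thesis"
      then have nz: "measure M (C p c) \<noteq> 0" for c by blast
      have "A = C p 0 \<union> C p 1" "C p 0 \<inter> C p 1 = {}"
        using sets.sets_into_space[OF A] borel_prob_space[OF M]
        by (auto simp: C_def space_borel_X)
      then have "measure M A = measure M (C p 0) + measure M (C p 1)"
        using finite_measure_Union[OF C(1)[of p 0] C(1)[of p 1]] by simp
      moreover have "measure M (C p c) > 0" for c using nz[of c]
          by (simp add: zero_less_measure_iff)
      ultimately have "0 < emeasure M (C p 0) \<and> emeasure M (C p 0) < emeasure M A"
        using \<open>\<And>c. measure M (C p c) > 0\<close>[of 0] \<open>\<And>c. measure M (C p c) > 0\<close>[of 1]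
        by (simp add: emeasure_eq_measure ennreal_less_iff)
      then show False using no C by blast
    qed
    then obtain c where c: "\<And>p. measure M (C p (c p)) = 0" by metis
    \<comment> \<open>adding \<open>1\<close> exchanges the two values: \<open>x\<close> is the only configuration not yet excluded\<close>
    define x where "x p = c p + 1" for p
    have "C p (c p) \<in> null_sets M" for p
      using c[of p] C(1)[of p "c p"] by (simp add: null_sets_def emeasure_eq_measure)
    then have "(\<Union>p. C p (c p)) \<in> null_sets M" by (rule null_sets_UN)
    moreover have "led_X \<inter> {x} \<in> null_sets M"
    proof (cases "x \<in> led_X")
      case True
      then show ?thesis using null[OF True] singleton_set[OF True] by
          (auto simp: sets emeasure_eq_measure)
    qed simp
    ultimately have "(\<Union>p. C p (c p)) \<union> (led_X \<inter> {x}) \<in> null_sets M" by (rule null_sets.Un)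
    moreover have "A \<subseteq> (\<Union>p. C p (c p)) \<union> (led_X \<inter> {x})"
    proof
      fix y assume y: "y \<in> A"
      then have X: "y \<in> led_X" using sets.sets_into_space[OF A] borel_prob_space[OF M] by auto
      show "y \<in> (\<Union>p. C p (c p)) \<union> (led_X \<inter> {x})"
      proof (cases "\<exists>p. y p = c p")
        case True
        then show ?thesis using y X by (auto simp: C_def space_borel_X)
      next
        case False
        have "y p = x p" for p
        proof -
          have "y p \<noteq> c p" using False by blast
          then show ?thesis by (cases "y p"; cases "c p") (simp_all add: x_def)
        qed
        then have "y = x" by (rule ext)
        then show ?thesis using X by auto
      qed
    qed
    ultimately have "A \<in> null_sets M" using null_sets_subset[OF _ A] by blast
    then show False using pos by (simp add: null_setsD1)
  qed
qed

text \<open>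
  The points of the orbit of an aperiodic configuration are infinitely many and have equal mass.
\<close>
lemma mu_atomless:
  assumes M: "haar_prob M"
  shows "atomless (convolution_X (mu1 M) nu)"
proof (rule atomlessI)
  define \<mu> where "\<mu> = convolution_X (mu1 M) nu"
  have \<mu>: "borel_prob \<mu>" unfolding \<mu>_def by (rule mu_formula(1)[OF M])
  then show "borel_prob (convolution_X (mu1 M) nu)" by (simp add: \<mu>_def)
  have sets: "sets \<mu> = sets borel_X" using \<mu> by (simp add: borel_prob_def)
  interpret prob_space \<mu> using \<mu> by (simp add: borel_prob_def)
  fix x assume x: "x \<in> led_X"
  have "measure \<mu> {x} = 0"
  proof (cases "x \<in> ribbon_set")
    case False
    have "measure \<mu> {x} \<le> measure \<mu> (space \<mu> - ribbon_set)"
      using False x ribbon_set_sets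
      by (intro finite_measure_mono sets.compl_sets) (simp_all add: sets borel_prob_space[OF \<mu>])
    also have "\<dots> = 0"
    proof -
      have "ribbon_set \<in> sets \<mu>" using ribbon_set_sets by (simp only: sets)
      from prob_compl[OF this] show ?thesis
        using mu_ribbon_set[OF M] unfolding \<mu>_def[symmetric] by simp
    qed
    finally show ?thesis by (simp add: measure_le_0_iff)
  next
    case True
    then obtain i j where "tame (act i j x)" by (auto simp: ribbon_set_def)
    then have ap: "aperiodic (act i j x)" by (simp add: tame_def)
    have distinct: "act m 0 x \<noteq> act m' 0 x" if "m \<noteq> m'" for m m'
    proof
      assume eq: "act m 0 x = act m' 0 x"
      have "act (m - m') 0 (act i j x) = act (i - m') j (act m 0 x)"
          by (simp add: act_act algebra_simps)
      also have "\<dots> = act i j x" unfolding eq by (simp add: act_act)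
      finally have "m - m' = 0" using ap unfolding aperiodic_def by blast
      then show False using that by simp
    qed
    have same: "measure \<mu> {act m 0 x} = measure \<mu> {x}" for m
    proof -
      have "distr \<mu> borel_X (act m 0) = \<mu>"
        using mu_invariant[OF M] by (simp add: invariant_measure_def \<mu>_def)
      then have "measure \<mu> {act m 0 x} = measure \<mu> {y \<in> led_X. act m 0 y \<in> {act m 0 x}}"
        using borel_prob_distr(2)[OF \<mu> act_measurable singleton_set[OF act_in_X[OF x]], of m 0 m 0] by simp
      also have "{y \<in> led_X. act m 0 y \<in> {act m 0 x}} = {x}"
      proof -
        have "y = x" if "act m 0 y = act m 0 x" for y
          using arg_cong[OF that, of "act (- m) 0"] by (simp add: act_act act_0)
        then show ?thesis using x by auto
      qed
      finally show ?thesis .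
    qed
    have "(\<lambda>m. measure \<mu> {act (int m) 0 x}) sums measure \<mu> (\<Union>m. {act (int m) 0 x})"
      using distinct singleton_set[OF act_in_X[OF x]]
      by (intro finite_measure_UNION) (auto simp: sets disjoint_family_on_def)
    then have "summable (\<lambda>m :: nat. measure \<mu> {x})" by (simp add: same sums_iff)
    then show ?thesis using summable_const_iff by blast
  qed
  then show "measure (convolution_X (mu1 M) nu) {x} = 0" by (simp add: \<mu>_def)
qed

section \<open>The measure is of ribbon type\<close>

text \<open>
  The countably many translates of \<open>led_Z\<close> have equal measure and cover the set \<open>ribbon_set\<close>, because
  every tame configuration has a gate.
\<close>
lemma mu_led_Z_pos:
  assumes M: "haar_prob M"
  shows "measure (convolution_X (mu1 M) nu) led_Z > 0"
proof (rule ccontr)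
  define \<mu> where "\<mu> = convolution_X (mu1 M) nu"
  have \<mu>: "borel_prob \<mu>" unfolding \<mu>_def by (rule mu_formula(1)[OF M])
  have sets: "sets \<mu> = sets borel_X" using \<mu> by (simp add: borel_prob_def)
  interpret prob_space \<mu> using \<mu> by (simp add: borel_prob_def)
  assume "\<not> measure (convolution_X (mu1 M) nu) led_Z > 0"
  then have zero: "measure \<mu> led_Z = 0" by (simp add: \<mu>_def zero_less_measure_iff)
  define W where "W p = {x \<in> led_X. act (fst p) (snd p) x \<in> led_Z}" for p
  have "W p \<in> null_sets \<mu>" for p
  proof -
    have "distr \<mu> borel_X (act (fst p) (snd p)) = \<mu>"
      using mu_invariant[OF M] by (simp add: invariant_measure_def \<mu>_def)
    then have "measure \<mu> (W p) = 0"
      using borel_prob_distr(2)[OF \<mu> act_measurable led_Z_sets, of "fst p" "snd p"] zero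
          by (simp add: W_def)
    then show ?thesis
      using act_set[OF led_Z_sets] by (auto simp: W_def sets emeasure_eq_measure)
  qed
  then have null: "(\<Union>p. W p) \<in> null_sets \<mu>" by (rule null_sets_UN)
  have "ribbon_set \<subseteq> (\<Union>p. W p)"
  proof
    fix x assume "x \<in> ribbon_set"
    then obtain m n where x: "x \<in> led_X" "tame (act m n x)" by (auto simp: ribbon_set_def)
    define y where "y = act m n x"
    have y: "tame y" using x by (simp add: y_def)
    obtain g where g: "gate y 0 g" using gate_below[OF y] by blast
    then have "centred y g \<in> led_Z"
      using gate_in_ribbon[OF y g] y by (subst centred_in_Z) (auto simp: tame_def)
    then have "x \<in> W (fst g + m, snd g + n)"
      using x(1) by (simp add: W_def y_def centred_def act_act)
    then show "x \<in> (\<Union>p. W p)" by blast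
  qed
  moreover have "ribbon_set \<in> sets \<mu>" using ribbon_set_sets by (simp only: sets)
  ultimately have "ribbon_set \<in> null_sets \<mu>"
    using null_sets_subset[OF null] by blast
  then have "measure \<mu> ribbon_set = 0" by (rule measure_eq_0_null_sets)
  then show False using mu_ribbon_set[OF M] by (simp add: \<mu>_def)
qed

theorem proposition6p2:
  fixes \<mu>0 :: "config measure"
  assumes "haar_prob \<mu>0"
  shows "ribbon_type (convolution_X (mu1 \<mu>0) nu)"
  unfolding ribbon_type_def
proof (intro conjI bexI[of _ ribbon_set])
  show "invariant_set ribbon_set" by (rule invariant_setI[OF act_ribbon_set])
  have tame_orbit: "\<exists>y p. tame y \<and> x = centred y p" if "x \<in> ribbon_set" for x
  proof -
    obtain m n where "tame (act m n x)" using \<open>x \<in> ribbon_set\<close> by (auto simp: ribbon_set_def)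
    moreover have "x = centred (act m n x) (- m, - n)" by (simp add: centred_def act_act act_0)
    ultimately show ?thesis by blast
  qed
  show "\<forall>x\<in>led_Y \<inter> ribbon_set. sigma_component x \<inter> led_Z \<noteq> {}"
    using tame_orbit tame_ribbons(1) by blast
  show "\<forall>x\<in>led_Z \<inter> ribbon_set. \<exists>!y. y \<in> led_Y \<and> led_sigma y = x \<and> y \<in> led_Z"
    using tame_orbit tame_ribbons(2) by blast
  show "\<forall>x\<in>led_Y \<inter> ribbon_set. infinite (sigma_components_of_orbit x) \<and>
      (\<forall>C\<in>sigma_components_of_orbit x. \<exists>!k. act k (- k) x \<in> led_Z \<inter> C) \<and>
      \<not> bdd_above {k. act k (- k) x \<in> led_Z} \<and> \<not> bdd_below {k. act k (- k) x \<in> led_Z}"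
  proof (intro ballI conjI)
    fix x assume "x \<in> led_Y \<inter> ribbon_set"
    then obtain y p where y: "tame y" "x = centred y p" using tame_orbit by blast
    show "infinite (sigma_components_of_orbit x)" by (rule tame_ribbons(6)[OF y])
    show "\<exists>!k. act k (- k) x \<in> led_Z \<inter> C" if "C \<in> sigma_components_of_orbit x" for C
      by (rule tame_ribbons(3)[OF y that])
    show "\<not> bdd_above {k. act k (- k) x \<in> led_Z}" by (rule tame_ribbons(4)[OF y])
    show "\<not> bdd_below {k. act k (- k) x \<in> led_Z}" by (rule tame_ribbons(5)[OF y])
  qed
  show "borel_prob (convolution_X (mu1 \<mu>0) nu)" by (rule mu_formula(1)[OF assms])
  show "atomless (convolution_X (mu1 \<mu>0) nu)" by (rule mu_atomless[OF assms])
  show "invariant_measure (convolution_X (mu1 \<mu>0) nu)" by (rule mu_invariant[OF assms])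
  show "ergodic (convolution_X (mu1 \<mu>0) nu)" by (rule mu_ergodic[OF assms])
  show "measure (convolution_X (mu1 \<mu>0) nu) led_Z > 0" by (rule mu_led_Z_pos[OF assms])
  show "ribbon_set \<in> sets borel_X" by (rule ribbon_set_sets)
  show "measure (convolution_X (mu1 \<mu>0) nu) ribbon_set = 1" by (rule mu_ribbon_set[OF assms])
qed

end
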